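(* The set of all equilibrium prices is non-empty and convex. If $p$ is an equilibrium price, then every admissible price system $q$ satisfying $p^{\sharp\sharp}(z)\le q(z)\le p^{\flat\flat}(z)$ for all $z\in Z$ is also an equilibrium price. Moreover, if $(p,\alpha,\beta)$ is an equilibrium, then $p^{\sharp\sharp}(z)=p(z)=p^{\flat\flat}(z)$ for $\alpha_Z$-almost every (equivalently $\beta_Z$-almost every) $z\in Z_0$.
   Context: Standing setting. $X\subset\mathbb R^{d_1}$, $Y\subset\mathbb R^{d_2}$, $Z_0\subset\mathbb R^{d_3}$ are compact sets (possibly finite). $\mu$ and $\nu$ are finite nonnegative Borel measures on $X$ and $Y$ respectively (atoms allowed; $\mu(X)\neq\nu(Y)$ allowed). $u$ is a continuous real function on a neighbourhood of $X\times Z_0$ in $\mathbb R^{d_1+d_3}$, differentiable with respect to $x$ with $D_xu$ continuous in $(x,z)$; $v$ is a continuous real function on a neighbourhood of $Y\times Z_0$ in $\mathbb R^{d_2+d_3}$, differentiable with respect to $y$ with $D_yv$ continuous in $(y,z)$. Let $\varnothing_d\neq\varnothing_s$ be two points not in $Z_0$ and $Z=Z_0\cup\{\varnothing_d\}\cup\{\varnothing_s\}$ (a compact set in which the two added points are isolated). Extend $u,v$ by $u(x,\varnothing_d)=0$, $u(x,\varnothing_s)=-1$, $v(y,\varnothing_s)=0$, $v(y,\varnothing_d)=1$. Define $b(z)=\max_{x\in X}u(x,z)$, $a(z)=\min_{y\in Y}v(y,z)$ for $z\in Z$, and $Z_1=\{z\in Z: a(z)\le b(z)\}$. A price system is a continuous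 $p:Z\to\mathbb R$ with $p(\varnothing_d)=p(\varnothing_s)=0$; it is admissible if $a(z)\le p(z)\le b(z)$ for all $z\in Z_1$. Given a price system $p$: $p^\sharp(x)=\max_{z\in Z}\{u(x,z)-p(z)\}$, $p^\flat(y)=\min_{z\in Z}\{v(y,z)-p(z)\}$, $p^{\sharp\sharp}(z)=\sup_{x\in X}\{u(x,z)-p^\sharp(x)\}$, $p^{\flat\flat}(z)=\inf_{y\in Y}\{v(y,z)-p^\flat(y)\}$, $D(x)=\arg\max_{z\in Z}\{u(x,z)-p(z)\}$, $S(y)=\arg\min_{z\in Z}\{v(y,z)-p(z)\}$. A demand distribution associated with $p$ is a positive Borel measure $\alpha$ on $X\times Z$ carried by the graph of $D$ with marginal $\mu$ on $X$; a supply distribution is a positive Borel measure $\beta$ on $Y\times Z$ carried by the graph of $S$ with marginal $\nu$ on $Y$. $\alpha_Z,\beta_Z$ denote marginals on $Z$. An equilibrium is a triple $(p,\alpha,\beta)$ with $p$ an admissible price system, $\alpha,\beta$ demand and supply distributions associated with $p$, and $\alpha_Z(A)=\beta_Z(A)$ for every Borel $A\subset Z_0$. An equilibrium price is a price system $p$ for which there exist $\alpha,\beta$ making $(p,\alpha,\beta)$ an equilibrium. *)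

theory Defs
  imports "HOL-Analysis.Analysis"
begin

text \<open>The space Z = Z0 plus two isolated points.  Z0 lives in a Euclidean space 'z;
  we realise Z as a compact subset of 'z \<times> real: Z0 is embedded as Z0 \<times> {0}
  and the two extra points are (0,1) (the "no demand" point) and (0,2) (the "no supply" point).\<close>

definition zemb :: "'z::euclidean_space \<Rightarrow> 'z \<times> real" where
  "zemb z = (z, 0)"

definition znd :: "'z::euclidean_space \<times> real" where
  "znd = (0, 1)"

definition zns :: "'z::euclidean_space \<times> real" where
  "zns = (0, 2)"

definition Zset :: "'z::euclidean_space set \<Rightarrow> ('z \<times> real) set" where
  "Zset Z0 = zemb ` Z0 \<union> {znd, zns}"

definition uext :: "('x \<Rightarrow> 'z::euclidean_space \<Rightarrow> real) \<Rightarrow> 'x \<Rightarrow> 'z \<times> real \<Rightarrow> real" where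
  "uext u x w = (if w = znd then 0 else if w = zns then -1 else u x (fst w))"

definition vext :: "('y \<Rightarrow> 'z::euclidean_space \<Rightarrow> real) \<Rightarrow> 'y \<Rightarrow> 'z \<times> real \<Rightarrow> real" where
  "vext v y w = (if w = zns then 0 else if w = znd then 1 else v y (fst w))"

definition bfun :: "'x set \<Rightarrow> ('x \<Rightarrow> 'w \<Rightarrow> real) \<Rightarrow> 'w \<Rightarrow> real" where
  "bfun X U w = (SUP x\<in>X. U x w)"

definition afun :: "'y set \<Rightarrow> ('y \<Rightarrow> 'w \<Rightarrow> real) \<Rightarrow> 'w \<Rightarrow> real" where
  "afun Y V w = (INF y\<in>Y. V y w)"

definition Z1set :: "'x set \<Rightarrow> 'y set \<Rightarrow> 'z::euclidean_space set
    \<Rightarrow> ('x \<Rightarrow> 'z \<times> real \<Rightarrow> real) \<Rightarrow> ('y \<Rightarrow> 'z \<times> real \<Rightarrow> real) \<Rightarrow> ('z \<times> real) set" where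
  "Z1set X Y Z0 U V = {w \<in> Zset Z0. afun Y V w \<le> bfun X U w}"

definition price_system :: "'z::euclidean_space set \<Rightarrow> ('z \<times> real \<Rightarrow> real) \<Rightarrow> bool" where
  "price_system Z0 p \<longleftrightarrow> continuous_on (Zset Z0) p \<and> p znd = 0 \<and> p zns = 0"

definition admissible :: "'x set \<Rightarrow> 'y set \<Rightarrow> 'z::euclidean_space set
    \<Rightarrow> ('x \<Rightarrow> 'z \<times> real \<Rightarrow> real) \<Rightarrow> ('y \<Rightarrow> 'z \<times> real \<Rightarrow> real) \<Rightarrow> ('z \<times> real \<Rightarrow> real) \<Rightarrow> bool" where
  "admissible X Y Z0 U V p \<longleftrightarrow> price_system Z0 p \<and>
     (\<forall>w \<in> Z1set X Y Z0 U V. afun Y V w \<le> p w \<and> p w \<le> bfun X U w)"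

definition psharp :: "'z::euclidean_space set \<Rightarrow> ('x \<Rightarrow> 'z \<times> real \<Rightarrow> real) \<Rightarrow> ('z \<times> real \<Rightarrow> real) \<Rightarrow> 'x \<Rightarrow> real" where
  "psharp Z0 U p x = (SUP w\<in>Zset Z0. U x w - p w)"

definition pflat :: "'z::euclidean_space set \<Rightarrow> ('y \<Rightarrow> 'z \<times> real \<Rightarrow> real) \<Rightarrow> ('z \<times> real \<Rightarrow> real) \<Rightarrow> 'y \<Rightarrow> real" where
  "pflat Z0 V p y = (INF w\<in>Zset Z0. V y w - p w)"

definition psharpsharp :: "'x set \<Rightarrow> 'z::euclidean_space set \<Rightarrow> ('x \<Rightarrow> 'z \<times> real \<Rightarrow> real) \<Rightarrow> ('z \<times> real \<Rightarrow> real) \<Rightarrow> 'z \<times> real \<Rightarrow> real" where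
  "psharpsharp X Z0 U p w = (SUP x\<in>X. U x w - psharp Z0 U p x)"

definition pflatflat :: "'y set \<Rightarrow> 'z::euclidean_space set \<Rightarrow> ('y \<Rightarrow> 'z \<times> real \<Rightarrow> real) \<Rightarrow> ('z \<times> real \<Rightarrow> real) \<Rightarrow> 'z \<times> real \<Rightarrow> real" where
  "pflatflat Y Z0 V p w = (INF y\<in>Y. V y w - pflat Z0 V p y)"

definition Dcorr :: "'z::euclidean_space set \<Rightarrow> ('x \<Rightarrow> 'z \<times> real \<Rightarrow> real) \<Rightarrow> ('z \<times> real \<Rightarrow> real) \<Rightarrow> 'x \<Rightarrow> ('z \<times> real) set" where
  "Dcorr Z0 U p x = {w \<in> Zset Z0. \<forall>w' \<in> Zset Z0. U x w' - p w' \<le> U x w - p w}"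

definition Scorr :: "'z::euclidean_space set \<Rightarrow> ('y \<Rightarrow> 'z \<times> real \<Rightarrow> real) \<Rightarrow> ('z \<times> real \<Rightarrow> real) \<Rightarrow> 'y \<Rightarrow> ('z \<times> real) set" where
  "Scorr Z0 V p y = {w \<in> Zset Z0. \<forall>w' \<in> Zset Z0. V y w - p w \<le> V y w' - p w'}"

definition demand_dist :: "'x::euclidean_space set \<Rightarrow> 'z::euclidean_space set \<Rightarrow> ('x \<Rightarrow> 'z \<times> real \<Rightarrow> real)
    \<Rightarrow> 'x measure \<Rightarrow> ('z \<times> real \<Rightarrow> real) \<Rightarrow> ('x \<times> ('z \<times> real)) measure \<Rightarrow> bool" where
  "demand_dist X Z0 U mu p \<alpha> \<longleftrightarrow>
     sets \<alpha> = sets (restrict_space borel (X \<times> Zset Z0)) \<and>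
     (AE xw in \<alpha>. snd xw \<in> Dcorr Z0 U p (fst xw)) \<and>
     distr \<alpha> (restrict_space borel X) fst = mu"

definition supply_dist :: "'y::euclidean_space set \<Rightarrow> 'z::euclidean_space set \<Rightarrow> ('y \<Rightarrow> 'z \<times> real \<Rightarrow> real)
    \<Rightarrow> 'y measure \<Rightarrow> ('z \<times> real \<Rightarrow> real) \<Rightarrow> ('y \<times> ('z \<times> real)) measure \<Rightarrow> bool" where
  "supply_dist Y Z0 V nu p \<beta> \<longleftrightarrow>
     sets \<beta> = sets (restrict_space borel (Y \<times> Zset Z0)) \<and>
     (AE yw in \<beta>. snd yw \<in> Scorr Z0 V p (fst yw)) \<and>
     distr \<beta> (restrict_space borel Y) fst = nu"

definition zmarg :: "'z::euclidean_space set \<Rightarrow> ('a \<times> ('z \<times> real)) measure \<Rightarrow> ('z \<times> real) measure" where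
  "zmarg Z0 \<alpha> = distr \<alpha> (restrict_space borel (Zset Z0)) snd"

definition equilibrium :: "'x::euclidean_space set \<Rightarrow> 'y::euclidean_space set \<Rightarrow> 'z::euclidean_space set
    \<Rightarrow> ('x \<Rightarrow> 'z \<times> real \<Rightarrow> real) \<Rightarrow> ('y \<Rightarrow> 'z \<times> real \<Rightarrow> real) \<Rightarrow> 'x measure \<Rightarrow> 'y measure
    \<Rightarrow> ('z \<times> real \<Rightarrow> real) \<Rightarrow> ('x \<times> ('z \<times> real)) measure \<Rightarrow> ('y \<times> ('z \<times> real)) measure \<Rightarrow> bool" where
  "equilibrium X Y Z0 U V mu nu p \<alpha> \<beta> \<longleftrightarrow>
     admissible X Y Z0 U V p \<and> demand_dist X Z0 U mu p \<alpha> \<and> supply_dist Y Z0 V nu p \<beta> \<and>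
     (\<forall>A \<in> sets (restrict_space borel (Zset Z0)). A \<subseteq> zemb ` Z0 \<longrightarrow>
        emeasure (zmarg Z0 \<alpha>) A = emeasure (zmarg Z0 \<beta>) A)"

definition equilibrium_price :: "'x::euclidean_space set \<Rightarrow> 'y::euclidean_space set \<Rightarrow> 'z::euclidean_space set
    \<Rightarrow> ('x \<Rightarrow> 'z \<times> real \<Rightarrow> real) \<Rightarrow> ('y \<Rightarrow> 'z \<times> real \<Rightarrow> real) \<Rightarrow> 'x measure \<Rightarrow> 'y measure
    \<Rightarrow> ('z \<times> real \<Rightarrow> real) \<Rightarrow> bool" where
  "equilibrium_price X Y Z0 U V mu nu p \<longleftrightarrow> (\<exists>\<alpha> \<beta>. equilibrium X Y Z0 U V mu nu p \<alpha> \<beta>)"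

end

(* The equilibrium price is found as a zero-noise limit.  On a finite grid of qualities with finitely
   many agents, let every agent choose by the logit rule with noise eps.  Clearing at a quality w then
   reads exp(-p/eps) A = exp(p/eps) B, where A and B are the logit masses offered by the two sides,
   i.e. p = eps/2 (ln A - ln B) =: F p.  F is monotone and, thanks to the outside options, maps a fixed
   box into itself, so iterating it converges to an exactly clearing price.  The fixed-point equation
   also shows that p inherits the moduli of continuity of u and v, uniformly in the grid and in eps,
   whence Arzela-Ascoli gives a limit price.  The logit distributions converge weakly along a
   subsequence: every compact set is a continuous image of a compact subset of the real line, which
   reduces weak compactness to Helly's selection theorem.  As a logit choice misses the optimum by
   at most (number of options) * eps on average, the limit distributions sit on the argmax graphs.

   The remaining claims are linear programming duality: the duality gap of (p, alpha, beta) is the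
   integral of a nonnegative function vanishing exactly on the argmax graphs, and prices cancel in it
   by market clearing. *)

theory Submission
  imports Defs "HOL-Probability.Probability" "HOL-Complex_Analysis.Great_Picard"
begin

section \<open>Compact sets as continuous images of real compact sets\<close>

text \<open>A fixed box for F has to exist before anything can be iterated. Each agent's outside
  option has utility 0 and price 0, so logit denominators never drop below 1. Hence a price bound M
  enters ln A - ln B only once, as M / eps, and the factor eps/2 leaves M/2: there is room for a
  bound M independent of grid and noise. The outside options also absorb any excess of one side,
  because prices at the two added points are held at 0 and no clearing is asked there; so the two
  total masses may differ. The noise is chosen after the grid, small enough to beat its cardinality.

  The limit price clears the market but may violate admissibility at untraded qualities; this is
  repaired afterwards by clipping it between the bounds. Convexity of the set of prices is not
  immediate, since two equilibrium prices come with different distributions; duality shows that the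
  distributions of one equilibrium also support the price of the other.\<close>

definition digit_seqs :: "(nat \<Rightarrow> real) set" where
  "digit_seqs = PiE UNIV (\<lambda>_. {0, 1})"

lemma compact_digit_seqs: "compact digit_seqs"
proof -
  have "compactin (product_topology (\<lambda>_::nat. euclidean) UNIV) digit_seqs"
    unfolding digit_seqs_def compactin_PiE by simp
  then show ?thesis by (simp add: euclidean_product_topology)
qed

lemma digit_seqs_norm_le: "d \<in> digit_seqs \<Longrightarrow> \<bar>d k\<bar> \<le> 1"
  by (cases "d k = 0") (auto simp: digit_seqs_def PiE_iff)

text \<open>The map \<open>j\<close> selects the digits that are read, so one sequence can encode
  several coordinates at once. Digits are bounded by 1, so the Weierstrass M-test applies with
  majorant \<open>c\<close>.\<close>

lemma continuous_on_digit_series: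
  fixes c :: "nat \<Rightarrow> real" and j :: "nat \<Rightarrow> nat"
  assumes "\<And>k. c k \<ge> 0" "summable c"
  shows "continuous_on digit_seqs (\<lambda>d. \<Sum>k. d (j k) * c k)"
proof (rule uniform_limit_theorem)
  show "uniform_limit digit_seqs (\<lambda>n d. \<Sum>k<n. d (j k) * c k) (\<lambda>d. \<Sum>k. d (j k) * c k) sequentially"
    by (rule Weierstrass_m_test[OF _ assms(2)])
      (use assms(1) digit_seqs_norm_le in \<open>auto simp: abs_mult intro!: mult_left_le_one_le\<close>)
  have "continuous_on digit_seqs (\<lambda>d. d (j k))" for k
    by (rule continuous_on_subset[OF continuous_on_product_coordinates]) simp
  then show "\<forall>\<^sub>F n in sequentially. continuous_on digit_seqs (\<lambda>d. \<Sum>k<n. d (j k) * c k)"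
    by (intro always_eventually allI continuous_intros)
qed simp

text \<open>Base 3 with digits 0 and 1 avoids the ambiguity of base 2: at the first differing index
  n the term has size (1/3)^n, and the whole tail after it at most half of that, so the tail cannot
  cancel it.\<close>

lemma inj_on_ternary_series: "inj_on (\<lambda>d. \<Sum>k. d k * (1/3::real)^k) digit_seqs"
proof (rule inj_onI, rule ccontr)
  fix d d' assume d: "d \<in> digit_seqs" and d': "d' \<in> digit_seqs"
    and eq: "(\<Sum>k. d k * (1/3::real)^k) = (\<Sum>k. d' k * (1/3)^k)" and ne: "d \<noteq> d'"
  define n where "n = (LEAST k. d k \<noteq> d' k)"
  have n: "d n \<noteq> d' n" unfolding n_def by (rule LeastI_ex) (use ne in auto)
  have less: "d k = d' k" if "k < n" for k
    using not_less_Least[OF that[unfolded n_def]] by simp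
  have bd: "\<bar>d k - d' k\<bar> \<le> 1" for k
    using d d' by (auto simp: digit_seqs_def PiE_iff) (metis abs_0 abs_minus_cancel abs_one diff_0 diff_0_right diff_self zero_le_one order_refl)
  have hd: "\<bar>d n - d' n\<bar> = 1"
    using d d' n by (auto simp: digit_seqs_def PiE_iff) (metis abs_minus_cancel abs_one diff_0 diff_0_right)
  let ?f = "\<lambda>k. (d k - d' k) * (1/3::real)^k"
  have sg: "summable (\<lambda>k. (1/3::real)^k)" by (intro summable_geometric) simp
  have sd: "summable (\<lambda>k. e k * (1/3::real)^k)" if "e \<in> digit_seqs" for e
    by (rule summable_comparison_test[OF _ sg])
      (use digit_seqs_norm_le[OF that] in \<open>auto simp: abs_mult intro!: exI[of _ 0] mult_left_le_one_le\<close>)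
  have sf: "summable ?f" and "suminf ?f = 0"
    using summable_diff[OF sd[OF d] sd[OF d']] suminf_diff[OF sd[OF d] sd[OF d']] eq
    by (simp_all add: left_diff_distrib)
  moreover have "suminf ?f = (\<Sum>k. ?f (k + Suc n)) + (\<Sum>k<Suc n. ?f k)"
    by (rule suminf_split_initial_segment[OF sf])
  moreover have "(\<Sum>k<Suc n. ?f k) = ?f n"
    using less by simp
  ultimately have "(\<Sum>k. ?f (k + Suc n)) = - ?f n"
    by linarith
  moreover have "\<bar>?f n\<bar> = (1/3)^n"
    using hd by (simp add: abs_mult)
  ultimately have e1: "\<bar>\<Sum>k. ?f (k + Suc n)\<bar> = (1/3)^n"
    by linarith
  have sgt: "summable (\<lambda>k. (1/3::real)^(k + Suc n))"
    using summable_ignore_initial_segment[OF sg] .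
  have le: "\<bar>?f k\<bar> \<le> (1/3)^k" for k
    using bd[of k] by (auto simp: abs_mult intro!: mult_left_le_one_le)
  have sa: "summable (\<lambda>k. \<bar>?f (k + Suc n)\<bar>)"
  proof (rule summable_comparison_test[OF _ sgt], intro exI allI impI)
    show "norm \<bar>?f (k + Suc n)\<bar> \<le> (1/3)^(k + Suc n)" for k
      using le[of "k + Suc n"] by (simp only: real_norm_def abs_idempotent)
  qed
  have "\<bar>\<Sum>k. ?f (k + Suc n)\<bar> \<le> (\<Sum>k. \<bar>?f (k + Suc n)\<bar>)"
    using summable_rabs[OF sa] .
  also have "\<dots> \<le> (\<Sum>k. (1/3::real)^(k + Suc n))"
    by (rule suminf_le[OF le sa sgt])
  also have "\<dots> = (\<Sum>k. (1/3::real)^k * (1/3)^Suc n)"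
    by (simp add: power_add)
  also have "\<dots> = (\<Sum>k. (1/3::real)^k) * (1/3)^Suc n"
    by (rule suminf_mult2[OF sg, symmetric])
  also have "\<dots> = (1/3)^n / 2"
    by (simp add: suminf_geometric)
  finally show False using e1 by (simp add: field_simps)
qed

section \<open>Binary expansions and a map of Cantor space onto a cube\<close>

definition binary_digit :: "real \<Rightarrow> nat \<Rightarrow> real" where
  "binary_digit y k = of_int (\<lfloor>2^Suc k * y\<rfloor> - 2 * \<lfloor>2^k * y\<rfloor>)"

lemma binary_digit_range: "binary_digit y k \<in> {0, 1}"
proof -
  have "\<lfloor>2 * z\<rfloor> - 2 * \<lfloor>z\<rfloor> = 0 \<or> \<lfloor>2 * z\<rfloor> - 2 * \<lfloor>z\<rfloor> = 1" for z :: real by linarith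
  from this[of "2^k * y"] show ?thesis by (auto simp: binary_digit_def mult.assoc)
qed

text \<open>The digits telescope: the n-th partial sum is the truncation floor(2^n y) / 2^n. The
  bounds on y make floor y = 0, which starts the telescoping.\<close>

lemma binary_digit_sums:
  assumes "0 \<le> y" "y < 1"
  shows "(\<lambda>k. binary_digit y k * (1/2)^Suc k) sums y"
proof -
  have part: "(\<Sum>k<n. binary_digit y k * (1/2)^Suc k) = \<lfloor>2^n * y\<rfloor> / 2^n" for n
  proof (induction n)
    case 0
    then show ?case using assms by (simp add: floor_eq_iff)
  next
    case (Suc n)
    then show ?case by (simp add: binary_digit_def field_simps)
  qed
  have "(\<lambda>n. \<lfloor>2^n * y\<rfloor> / 2^n) \<longlonglongrightarrow> y"
  proof (rule real_tendsto_sandwich)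
    have "y - (1/2)^n \<le> \<lfloor>2^n * y\<rfloor> / 2^n" for n
    proof -
      have "2^n * y - 1 \<le> of_int \<lfloor>2^n * y\<rfloor>" by linarith
      then have "(2^n * y - 1) / 2^n \<le> of_int \<lfloor>2^n * y\<rfloor> / 2^n"
        by (rule divide_right_mono) simp
      then show ?thesis by (simp add: diff_divide_distrib power_one_over)
    qed
    then show "\<forall>\<^sub>F n in sequentially. y - (1/2)^n \<le> \<lfloor>2^n * y\<rfloor> / 2^n" by simp
    have "\<lfloor>2^n * y\<rfloor> / 2^n \<le> y" for n :: nat by (simp add: field_simps)
    then show "\<forall>\<^sub>F n in sequentially. \<lfloor>2^n * y\<rfloor> / 2^n \<le> y" by simp
    have "(\<lambda>n. y - (1/2::real)^n) \<longlonglongrightarrow> y - 0"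
      by (intro tendsto_intros LIMSEQ_power_zero) simp
    then show "(\<lambda>n. y - (1/2::real)^n) \<longlonglongrightarrow> y" by simp
  qed auto
  then show ?thesis unfolding sums_def part .
qed

text \<open>Cantor space is the intermediary. The ternary series embeds it in the line, with
  continuous inverse by compactness; interleaved binary expansions followed by scaling map it over a
  box that contains K. The preimage of K is the required set.\<close>

theorem compact_continuous_image_of_real_compact:
  fixes K :: "'a::euclidean_space set"
  assumes K: "compact K"
  obtains C :: "real set" and \<phi> where "compact C" "continuous_on C \<phi>" "\<phi> ` C = K"
proof -
  obtain e :: "'a \<Rightarrow> nat" where e: "inj_on e Basis"
    using finite_imp_inj_to_nat_seg[OF finite_Basis] by metis
  \<comment> \<open>Pairing the label of a basis vector with k gives every coordinate its own
    infinite set of digit positions, disjoint from the others.\<close>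
  define j where "j b k = prod_encode (e b, k)" for b k
  define g where "g d = (\<Sum>b\<in>Basis. (\<Sum>k. d (j b k) * (1/2::real)^Suc k) *\<^sub>R (b::'a))" for d
  have sm: "summable (\<lambda>k. (1/2::real)^Suc k)"
    by (intro summable_mult summable_geometric | simp)+
  have cg: "continuous_on digit_seqs g"
    unfolding g_def by (intro continuous_intros continuous_on_digit_series sm) simp
  have surj: "\<exists>d\<in>digit_seqs. g d = x" if x: "\<And>b. b \<in> Basis \<Longrightarrow> 0 \<le> x \<bullet> b \<and> x \<bullet> b < 1" for x
  proof -
    define d where "d m = binary_digit (x \<bullet> inv_into Basis e (fst (prod_decode m))) (snd (prod_decode m))" for m
    have "d \<in> digit_seqs"
      using binary_digit_range by (auto simp: digit_seqs_def PiE_iff d_def)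
    moreover have "d (j b k) = binary_digit (x \<bullet> b) k" if "b \<in> Basis" for b k
      using that e by (simp add: d_def j_def)
    then have "(\<Sum>k. d (j b k) * (1/2)^Suc k) = x \<bullet> b" if "b \<in> Basis" for b
      using binary_digit_sums[of "x \<bullet> b"] x[OF that] that by (simp add: sums_unique[symmetric])
    then have "g d = x" unfolding g_def by (simp add: euclidean_representation)
    ultimately show ?thesis by blast
  qed
  define h where "h d = (\<Sum>k. d k * (1/3::real)^k)" for d
  have ch: "continuous_on digit_seqs h"
    unfolding h_def by (rule continuous_on_digit_series) (auto intro: summable_geometric)
  have ih: "inj_on h digit_seqs"
    using inj_on_ternary_series unfolding h_def .
  have ci: "continuous_on (h ` digit_seqs) (inv_into digit_seqs h)"
    by (rule continuous_on_inv[OF ch compact_digit_seqs]) (use ih in auto)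
  obtain R where R: "R > 0" "\<And>x. x \<in> K \<Longrightarrow> norm x < R"
    using compact_imp_bounded[OF K] bounded_pos_less by metis
  \<comment> \<open>\<open>g\<close> is known to reach all of [0,1)^d. The affine map carries this
    onto [-R,R)^d, which contains K because norms in K are strictly below R.\<close>
  define \<phi> where "\<phi> t = (2 * R) *\<^sub>R g (inv_into digit_seqs h t) - R *\<^sub>R One" for t
  have im: "inv_into digit_seqs h ` h ` digit_seqs \<subseteq> digit_seqs"
    using ih by auto
  have c\<phi>: "continuous_on (h ` digit_seqs) \<phi>"
    unfolding \<phi>_def
    by (intro continuous_intros continuous_on_compose2[OF cg ci] im)
  have ch': "compact (h ` digit_seqs)"
    by (rule compact_continuous_image[OF ch compact_digit_seqs])
  define C where "C = h ` digit_seqs \<inter> \<phi> -` K"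
  have "closed C"
    unfolding C_def using c\<phi> compact_imp_closed[OF ch'] compact_imp_closed[OF K]
    by (rule continuous_closed_preimage)
  then have "compact C"
    using ch' compact_Int_closed[of "h ` digit_seqs" C] by (simp add: C_def Int_absorb1 flip: Int_assoc)
  moreover have "continuous_on C \<phi>"
    using c\<phi> by (rule continuous_on_subset) (auto simp: C_def)
  moreover have "\<phi> ` C = K"
  proof
    show "K \<subseteq> \<phi> ` C"
    proof
      fix x assume x: "x \<in> K"
      define y where "y = (1 / (2 * R)) *\<^sub>R (x + R *\<^sub>R One)"
      have "0 \<le> y \<bullet> b \<and> y \<bullet> b < 1" if "b \<in> Basis" for b
        using Basis_le_norm[OF that, of x] R(1) R(2)[OF x] that
        by (auto simp: y_def inner_add_left field_simps)
      from surj[OF this] obtain d where d: "d \<in> digit_seqs" "g d = y" by blast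
      have "\<phi> (h d) = x"
        using d ih R(1) by (simp add: \<phi>_def y_def)
      then show "x \<in> \<phi> ` C" using d x by (auto simp: C_def intro!: image_eqI[of _ _ "h d"])
    qed
  qed (auto simp: C_def)
  ultimately show ?thesis by (rule that)
qed

section \<open>Weak limits and approximation by finitely supported measures\<close>

text \<open>The atoms are pulled back to C by a right inverse \<open>\<sigma>\<close> of the
  surjection, Helly's theorem is applied there, and the limit law is pushed forward along
  \<open>\<phi>\<close>. Although \<open>\<sigma>\<close> may be wildly discontinuous, it is
  measurable for a point measure on a finite set.\<close>

theorem finitely_supported_weak_limit:
  fixes K :: "'a::euclidean_space set" and A :: "nat \<Rightarrow> 'a set" and w :: "nat \<Rightarrow> 'a \<Rightarrow> real"
  assumes K: "compact K"
    and A: "\<And>n. finite (A n)" "\<And>n. A n \<subseteq> K"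
    and w: "\<And>n a. a \<in> A n \<Longrightarrow> 0 \<le> w n a" "\<And>n. 0 < sum (w n) (A n)"
    and c: "(\<lambda>n. sum (w n) (A n)) \<longlonglongrightarrow> c"
  obtains r M where "strict_mono r" "finite_measure M" "sets M = sets (restrict_space borel K)"
    "\<And>f::'a \<Rightarrow> real. continuous_on K f \<Longrightarrow>
       (\<lambda>n. \<Sum>a\<in>A (r n). w (r n) a * f a) \<longlonglongrightarrow> (\<integral>a. f a \<partial>M)"
proof -
  obtain C :: "real set" and \<phi> where C: "compact C" and c\<phi>: "continuous_on C \<phi>" and \<phi>C: "\<phi> ` C = K"
    using compact_continuous_image_of_real_compact[OF K] by metis
  define \<sigma> where "\<sigma> = inv_into C \<phi>"
  have \<sigma>: "\<sigma> a \<in> C" "\<phi> (\<sigma> a) = a" if "a \<in> K" for a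
    using that \<phi>C by (auto simp: \<sigma>_def inv_into_into f_inv_into_f)
  define S where "S n = sum (w n) (A n)" for n
  have S: "S n > 0" for n using w(2) by (simp add: S_def)
  define P where "P n = point_measure (A n) (\<lambda>a. ennreal (w n a / S n))" for n
  define \<mu> where "\<mu> n = distr (P n) borel \<sigma>" for n
  have spP: "space (P n) = A n" for n by (simp add: P_def space_point_measure)
  have psP: "prob_space (P n)" for n
    unfolding P_def
  proof (rule prob_space_point_measure)
    have "(\<Sum>a\<in>A n. ennreal (w n a / S n)) = ennreal (\<Sum>a\<in>A n. w n a / S n)"
      using w(1) S[of n] by (intro sum_ennreal) (simp add: less_imp_le)
    also have "(\<Sum>a\<in>A n. w n a / S n) = 1"
      using S[of n] by (simp add: S_def flip: sum_divide_distrib)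
    finally show "(\<Sum>a\<in>A n. ennreal (w n a / S n)) = 1" by simp
  qed (use A(1) in auto)
  have m\<sigma>: "\<sigma> \<in> measurable (P n) borel" for n by (simp add: P_def)
  have rd: "real_distribution (\<mu> n)" for n
    unfolding \<mu>_def using psP m\<sigma> by (rule prob_space.real_distribution_distr)
  have int\<mu>: "(\<integral>t. f t \<partial>\<mu> n) = (\<Sum>a\<in>A n. w n a * f (\<sigma> a)) / S n"
    if f: "f \<in> borel_measurable borel" for f :: "real \<Rightarrow> real" and n
  proof -
    have "(\<integral>t. f t \<partial>\<mu> n) = (\<integral>a. f (\<sigma> a) \<partial>P n)"
      unfolding \<mu>_def by (rule integral_distr[OF m\<sigma> f])
    also have "\<dots> = (\<Sum>a\<in>A n. (w n a / S n) *\<^sub>R f (\<sigma> a))"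
      unfolding P_def using A(1) w(1) S[of n]
      by (intro lebesgue_integral_point_measure_finite) auto
    finally show ?thesis by (simp add: sum_divide_distrib)
  qed
  obtain R where R: "R > 0" "\<And>t. t \<in> C \<Longrightarrow> norm t < R"
    using compact_imp_bounded[OF C] bounded_pos_less by metis
  have "tight \<mu>"
    unfolding tight_def
  proof (intro conjI allI impI)
    fix \<epsilon> :: real assume "\<epsilon> > 0"
    have "measure (\<mu> n) {-R<..R} = 1" for n
    proof -
      have "\<sigma> -` {-R<..R} \<inter> A n = A n"
        using R(2)[OF \<sigma>(1)] A(2)[of n] by fastforce
      then have "measure (\<mu> n) {-R<..R} = measure (P n) (space (P n))"
        unfolding \<mu>_def by (subst measure_distr[OF m\<sigma>]) (auto simp: spP)
      then show ?thesis using prob_space.prob_space[OF psP] by simp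
    qed
    then show "\<exists>a b. a < b \<and> (\<forall>n. 1 - \<epsilon> < measure (\<mu> n) {a<..b})"
      using \<open>\<epsilon> > 0\<close> R(1) by (intro exI[of _ "-R"] exI[of _ R]) simp
  qed (rule rd)
  from tight_imp_convergent_subsubsequence[OF this strict_mono_id]
  obtain r M where r: "strict_mono r" and M: "real_distribution M" and wc: "weak_conv_m (\<mu> \<circ> r) M"
    by auto
  interpret M: real_distribution M by fact
  have conv: "(\<lambda>n. \<integral>t. f t \<partial>\<mu> (r n)) \<longlonglongrightarrow> (\<integral>t. f t \<partial>M)"
    if "continuous_on UNIV f" "\<And>t. norm (f t) \<le> B" for f :: "real \<Rightarrow> real" and B
    using weak_conv_imp_integral_bdd_continuous_conv[OF _ M wc, of f B] that rd
    by (auto simp: continuous_on_eq_continuous_at)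
  have "C \<noteq> {}" using w(2)[of 0] A(2)[of 0] \<phi>C by fastforce
  \<comment> \<open>The approximating laws live on the closed set C, so the bounded continuous
    function min(1, dist(t, C)) has integral 0 along the sequence and therefore in the
    limit.\<close>
  have AEC: "AE t in M. t \<in> C"
  proof -
    let ?f = "\<lambda>t. min 1 (infdist t C)"
    have cf: "continuous_on UNIV ?f" by (intro continuous_intros)
    have "(\<lambda>n. \<integral>t. ?f t \<partial>\<mu> (r n)) \<longlonglongrightarrow> (\<integral>t. ?f t \<partial>M)"
      by (rule conv[OF cf, of 1]) (simp add: infdist_nonneg)
    moreover have "(\<integral>t. ?f t \<partial>\<mu> n) = 0" for n
      using A(2)[of n] \<sigma>(1)
      by (subst int\<mu>[OF borel_measurable_continuous_onI[OF cf]]) (auto intro!: sum.neutral)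
    ultimately have "(\<integral>t. ?f t \<partial>M) = 0" by (simp add: LIMSEQ_const_iff)
    moreover have "integrable M ?f"
      using borel_measurable_continuous_onI[OF cf]
      by (intro M.integrable_const_bound[of _ 1]) (auto simp: infdist_nonneg)
    ultimately have "AE t in M. ?f t = 0"
      by (subst (asm) integral_nonneg_eq_0_iff_AE) (auto simp: infdist_nonneg)
    then show ?thesis
      by eventually_elim
        (use compact_imp_closed[OF C] \<open>C \<noteq> {}\<close> in \<open>auto simp: in_closed_iff_infdist_zero min_def split: if_splits\<close>)
  qed
  have c0: "c \<ge> 0" using c S by (intro LIMSEQ_le_const[OF c]) (auto simp: S_def less_imp_le)
  have CM: "C \<in> sets M" using C by (simp add: compact_imp_closed borel_closed)
  have m\<phi>: "\<phi> \<in> measurable (restrict_space M C) (restrict_space borel K)"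
  proof (rule measurable_restrict_space2)
    have "\<phi> \<in> measurable (restrict_space borel C) borel"
      by (rule borel_measurable_continuous_on_restrict[OF c\<phi>])
    then show "\<phi> \<in> measurable (restrict_space M C) borel"
      using measurable_cong_sets[OF sets_restrict_space_cong[of M borel C] refl] by auto
  qed (use \<phi>C in \<open>auto simp: space_restrict_space\<close>)
  \<comment> \<open>\<open>\<phi>\<close> is controlled on C only, so the limit law is restricted to
    C before it is pushed forward.\<close>
  define N where "N = distr (restrict_space M C) (restrict_space borel K) \<phi>"
  \<comment> \<open>Undoes the normalisation to probability measures. The limit mass
    \<open>c\<close> may be 0, although every approximating mass is positive.\<close>
  define M' where "M' = density N (\<lambda>_. ennreal c)"
  have fN: "finite_measure N"
    unfolding N_def by (intro finite_measure.finite_measure_distr[OF _ m\<phi>] finite_measure_restrict_space CM)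
      (auto intro: M.finite_measure_axioms)
  show thesis
  proof (rule that[OF r])
    show sM': "sets M' = sets (restrict_space borel K)" by (simp add: M'_def N_def)
    show "finite_measure M'"
      unfolding M'_def using finite_measure.emeasure_finite[OF fN]
      by (intro finite_measureI) (auto simp: emeasure_density nn_integral_cmult ennreal_mult_eq_top_iff)
    fix f :: "'a \<Rightarrow> real" assume f: "continuous_on K f"
    have cfp: "continuous_on C (\<lambda>t. f (\<phi> t))"
      using f c\<phi> by (rule continuous_on_compose2) (simp add: \<phi>C)
    obtain B where B: "B \<ge> 0" "\<And>t. t \<in> C \<Longrightarrow> norm (f (\<phi> t)) \<le> B"
      using compact_imp_bounded[OF compact_continuous_image[OF cfp C]]
      by (auto simp: bounded_pos) (metis less_imp_le)
    \<comment> \<open>Weak convergence tests functions on the whole line, whereas f after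
      \<open>\<phi>\<close> makes sense on C; Tietze extends it with the same bound.\<close>
    obtain g where g: "continuous_on UNIV g" "\<And>t. t \<in> C \<Longrightarrow> g t = f (\<phi> t)" "\<And>t. norm (g t) \<le> B"
      using Tietze[OF cfp _ B, of UNIV] compact_imp_closed[OF C] by auto
    have mg: "g \<in> borel_measurable borel" using g(1) by (rule borel_measurable_continuous_onI)
    have fm: "f \<in> borel_measurable (restrict_space borel K)"
      by (rule borel_measurable_continuous_on_restrict[OF f])
    have "(\<integral>a. f a \<partial>M') = (\<integral>a. c *\<^sub>R f a \<partial>N)"
      unfolding M'_def using c0 fm by (intro integral_density) (auto simp: N_def)
    also have "\<dots> = c * (\<integral>a. f a \<partial>N)" by simp
    also have "(\<integral>a. f a \<partial>N) = (\<integral>t. f (\<phi> t) \<partial>restrict_space M C)"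
      unfolding N_def by (rule integral_distr[OF m\<phi> fm])
    also have "\<dots> = (\<integral>t. indicator C t *\<^sub>R f (\<phi> t) \<partial>M)"
      using CM by (intro integral_restrict_space) simp
    also have "\<dots> = (\<integral>t. g t \<partial>M)"
    proof (rule integral_cong_AE)
      show "(\<lambda>t. indicator C t *\<^sub>R f (\<phi> t)) \<in> borel_measurable M"
        using borel_measurable_continuous_on_indicator[OF _ cfp] CM
        by (simp cong: measurable_cong_sets)
      show "g \<in> borel_measurable M" using mg by simp
      show "AE t in M. indicator C t *\<^sub>R f (\<phi> t) = g t"
        using AEC by eventually_elim (simp add: g)
    qed
    finally have e: "(\<integral>a. f a \<partial>M') = c * (\<integral>t. g t \<partial>M)" .
    have "(\<lambda>n. S (r n) * (\<integral>t. g t \<partial>\<mu> (r n))) \<longlonglongrightarrow> c * (\<integral>t. g t \<partial>M)"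
      using conv[OF g(1,3)] LIMSEQ_subseq_LIMSEQ[OF c r] by (intro tendsto_mult) (auto simp: S_def o_def)
    moreover have "S n * (\<integral>t. g t \<partial>\<mu> n) = (\<Sum>a\<in>A n. w n a * f a)" for n
    proof -
      have "(\<Sum>a\<in>A n. w n a * g (\<sigma> a)) = (\<Sum>a\<in>A n. w n a * f a)"
        using A(2)[of n] by (intro sum.cong) (auto simp: g \<sigma> subset_iff)
      then show ?thesis using S[of n] by (simp add: int\<mu>[OF mg])
    qed
    ultimately show "(\<lambda>n. \<Sum>a\<in>A (r n). w (r n) a * f a) \<longlonglongrightarrow> (\<integral>a. f a \<partial>M')"
      by (simp add: e)
  qed
qed

text \<open>Closed subsets of K form an intersection-stable generator, and the indicator of a
  nonempty closed A is the limit of the continuous functions max(0, 1 - n dist(x, A)). Dominated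
  convergence turns equal integrals into equal measures of A.\<close>

lemma finite_measure_eqI_continuous:
  fixes K :: "'a::euclidean_space set"
  assumes K: "compact K"
    and M: "finite_measure M" "sets M = sets (restrict_space borel K)"
    and N: "finite_measure N" "sets N = sets (restrict_space borel K)"
    and eq: "\<And>f::'a \<Rightarrow> real. continuous_on K f \<Longrightarrow> (\<integral>x. f x \<partial>M) = (\<integral>x. f x \<partial>N)"
  shows "M = N"
proof -
  have closedK: "closed K" using K by (rule compact_imp_closed)
  let ?E = "{A. A \<subseteq> K \<and> closed A}"
  have "K \<in> sigma_sets UNIV (Collect closed)"
    using closedK by (intro sigma_sets.Basic) simp
  from sigma_sets_Int[OF this]
  have "sets (restrict_space borel K) = sigma_sets K ((\<inter>) K ` Collect closed)"
    unfolding borel_eq_closed sets_restrict_space by (simp add: sets_measure_of)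
  also have "(\<inter>) K ` Collect closed = ?E"
    using closedK by (auto simp: image_iff)
  finally have gen: "sets (restrict_space borel K) = sigma_sets K ?E" .
  have lim: "(\<lambda>n. \<integral>x. max 0 (1 - real n * infdist x A) \<partial>L) \<longlonglongrightarrow> measure L A"
    if A: "A \<subseteq> K" "closed A" "A \<noteq> {}" and L: "finite_measure L" "sets L = sets (restrict_space borel K)" for L A
  proof -
    interpret L: finite_measure L by fact
    have AL: "A \<in> sets L" unfolding L(2) gen using A by (intro sigma_sets.Basic) auto
    have spL: "space L = K" using sets_eq_imp_space_eq[OF L(2)] by (simp add: space_restrict_space)
    have "(\<lambda>n. \<integral>x. max 0 (1 - real n * infdist x A) \<partial>L) \<longlonglongrightarrow> (\<integral>x. indicator A x \<partial>L)"
    proof (rule integral_dominated_convergence[where w = "\<lambda>_. 1"])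
      show "(\<lambda>x. max 0 (1 - real n * infdist x A)) \<in> borel_measurable L" for n
      proof -
        have "(\<lambda>x. max 0 (1 - real n * infdist x A)) \<in> borel_measurable (restrict_space borel K)"
          by (intro borel_measurable_continuous_on_restrict continuous_intros)
        then show ?thesis using L(2) by (simp cong: measurable_cong_sets)
      qed
      show "AE x in L. (\<lambda>n. max 0 (1 - real n * infdist x A)) \<longlonglongrightarrow> indicator A x"
      proof (rule AE_I2)
        fix x
        show "(\<lambda>n. max 0 (1 - real n * infdist x A)) \<longlonglongrightarrow> indicator A x"
        proof (cases "x \<in> A")
          case False
          then have pos: "infdist x A > 0"
            using A infdist_pos_not_in_closed by blast
          have "\<forall>\<^sub>F n in sequentially. max 0 (1 - real n * infdist x A) = 0"
          proof -
            obtain n0 where "1 / infdist x A < real n0" using reals_Archimedean2 by blast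
            then have "1 \<le> real n * infdist x A" if "n \<ge> n0" for n
              using that pos by (simp add: divide_less_eq)
                (meson less_imp_le mult_right_mono of_nat_le_iff order_trans)
            then show ?thesis by (intro eventually_sequentiallyI[of n0]) simp
          qed
          then show ?thesis using False by (simp add: tendsto_eventually)
        qed simp
      qed
    qed (use AL infdist_nonneg in \<open>auto intro!: AE_I2 L.integrable_const mult_nonneg_nonneg\<close>)
    then show ?thesis using AL sets.sets_into_space[OF AL] by (simp add: Int_absorb2)
  qed
  have eqE: "emeasure M A = emeasure N A" if "A \<in> ?E" for A
  \<comment> \<open>The empty set is split off because \<open>infdist\<close> to it is 0 by
    convention, which would make the cut-off functions constantly 1.\<close>
  proof (cases "A = {}")
    case False
    have "(\<integral>x. max 0 (1 - real n * infdist x A) \<partial>M) = (\<integral>x. max 0 (1 - real n * infdist x A) \<partial>N)" for n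
      by (intro eq continuous_intros)
    moreover have "A \<subseteq> K" "closed A" using that by auto
    ultimately have "measure M A = measure N A"
      using LIMSEQ_unique[OF lim[OF _ _ False M]] lim[OF _ _ False N] by simp
    then show ?thesis
      using finite_measure.emeasure_eq_measure[OF M(1)] finite_measure.emeasure_eq_measure[OF N(1)] by simp
  qed simp
  show ?thesis
  proof (rule measure_eqI_generator_eq[where E = ?E and \<Omega> = K and A = "\<lambda>_. K"])
    show "Int_stable ?E" by (auto simp: Int_stable_def)
    show "range (\<lambda>_::nat. K) \<subseteq> ?E" using closedK by auto
    show "emeasure M K \<noteq> \<infinity>" for i :: nat using finite_measure.emeasure_finite[OF M(1)] by simp
  qed (use M N gen eqE in auto)
qed

section \<open>Discretising a finite measure on a compact set\<close>

lemma compact_finite_net: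
  fixes S :: "'a::metric_space set"
  assumes "compact S" "0 < \<delta>"
  obtains T where "T \<subseteq> S" "finite T" "S \<subseteq> (\<Union>x\<in>T. ball x \<delta>)"
proof (rule compactE_image[OF assms(1)])
  show "S \<subseteq> (\<Union>x\<in>S. ball x \<delta>)" using assms(2) by force
qed auto

text \<open>All mass is moved to net points less than 1/(n+1) away. This changes the integral of f
  by at most its oscillation at that scale times the total mass.\<close>

lemma finitely_supported_approximation:
  fixes X :: "'a::euclidean_space set" and mu :: "'a measure"
  assumes X: "compact X" "X \<noteq> {}"
    and mu: "finite_measure mu" "sets mu = sets (restrict_space borel X)"
  shows "\<exists>(I :: nat \<Rightarrow> 'a set) (m :: nat \<Rightarrow> 'a \<Rightarrow> real).
    (\<forall>n. finite (I n) \<and> I n \<subseteq> X \<and> (\<forall>a. 0 \<le> m n a) \<and> 0 < sum (m n) (I n)) \<and>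
    (\<forall>f. continuous_on X f \<longrightarrow> (\<lambda>n. \<Sum>a\<in>I n. m n a * f a) \<longlonglongrightarrow> (\<integral>x. f x \<partial>mu))"
proof -
  interpret mu: finite_measure mu by fact
  have sp: "space mu = X" using sets_eq_imp_space_eq[OF mu(2)] by (simp add: space_restrict_space)
  have meas: "f \<in> borel_measurable mu" if "continuous_on X f" for f :: "'a \<Rightarrow> real"
    using borel_measurable_continuous_on_restrict[OF that] mu(2) by (simp cong: measurable_cong_sets)
  \<comment> \<open>The error is expressed through a bound B and an oscillation e of f, so that a
    single discretisation at stage n serves all continuous f at once.\<close>
  define Q where "Q n I m \<longleftrightarrow> finite I \<and> I \<subseteq> X \<and> (\<forall>a. 0 \<le> m a) \<and> 0 < sum m I \<and>
      (\<forall>f e B. continuous_on X f \<longrightarrow> (\<forall>x\<in>X. \<bar>f x\<bar> \<le> B) \<longrightarrow>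
        (\<forall>x\<in>X. \<forall>y\<in>X. dist x y < 1 / real (Suc n) \<longrightarrow> \<bar>f x - f y\<bar> \<le> e) \<longrightarrow>
        \<bar>(\<Sum>a\<in>I. m a * f a) - (\<integral>x. f x \<partial>mu)\<bar> \<le> e * measure mu X + B / real (Suc n))" for n I and m :: "'a \<Rightarrow> real"
  have "\<exists>I m. Q n I m" for n
  proof -
    define \<delta> where "\<delta> = 1 / real (Suc n)"
    have \<delta>: "\<delta> > 0" by (simp add: \<delta>_def)
    obtain T where T: "T \<subseteq> X" "finite T" "X \<subseteq> (\<Union>x\<in>T. ball x \<delta>)"
      using compact_finite_net[OF X(1) \<delta>] .
    obtain l where l: "set l = T" using finite_list[OF T(2)] by blast
    \<comment> \<open>Taking the first suitable point in an enumeration of the net makes the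
      selection measurable.\<close>
    define j where "j y = (LEAST i. i < length l \<and> dist (l ! i) y < \<delta>)" for y
    have j: "j y < length l" "dist (l ! j y) y < \<delta>" if y: "y \<in> X" for y
    proof -
      obtain x where "x \<in> T" "y \<in> ball x \<delta>" using T(3) y by blast
      then have "x \<in> set l" "dist x y < \<delta>" using l by auto
      then have "\<exists>i. i < length l \<and> dist (l ! i) y < \<delta>" by (metis in_set_conv_nth)
      from LeastI_ex[OF this] show "j y < length l" "dist (l ! j y) y < \<delta>" by (auto simp: j_def)
    qed
    have mj: "j \<in> measurable mu (count_space UNIV)"
      unfolding j_def
    proof (rule measurable_Least)
      fix i
      have "(\<lambda>y. dist (l ! i) y) \<in> borel_measurable mu"
        by (intro meas continuous_intros)
      then show "Measurable.pred mu (\<lambda>y. i < length l \<and> dist (l ! i) y < \<delta>)"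
        by measurable
    qed
    define q where "q y = l ! j y" for y
    have q: "q y \<in> T" "dist (q y) y < \<delta>" if "y \<in> X" for y
      using j[OF that] l by (auto simp: q_def)
    have mq: "q \<in> measurable mu (count_space UNIV)"
      unfolding q_def by (rule measurable_compose[OF mj]) simp
    have mqa: "{y \<in> X. q y = a} \<in> sets mu" for a
      using measurable_sets[OF mq, of "{a}"] by (simp add: sp vimage_def Int_def conj_commute)
    obtain x0 where x0: "x0 \<in> T" using T(3) X(2) by fastforce
    \<comment> \<open>The extra mass \<open>\<delta>\<close> at one net point keeps the total weight
      positive even if \<open>mu\<close> is zero; it causes the error term B / (n+1).\<close>
    define m where "m a = measure mu {y \<in> X. q y = a} + (if a = x0 then \<delta> else 0)" for a
    have m: "0 \<le> m a" for a using \<delta> by (simp add: m_def)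
    have "m x0 > 0" using \<delta> by (simp add: m_def add_nonneg_pos)
    then have ms: "0 < sum m T" by (rule sum_pos2[OF T(2) x0]) (rule m)
    show ?thesis
      unfolding Q_def
    proof (intro exI conjI allI impI)
      fix f :: "'a \<Rightarrow> real" and e B
      assume f: "continuous_on X f" and B: "\<forall>x\<in>X. \<bar>f x\<bar> \<le> B"
        and e: "\<forall>x\<in>X. \<forall>y\<in>X. dist x y < 1 / real (Suc n) \<longrightarrow> \<bar>f x - f y\<bar> \<le> e"
      have fm: "integrable mu f"
        using meas[OF f] B by (intro mu.integrable_const_bound[of _ B]) (auto simp: sp)
      have "(\<integral>y. f (q y) \<partial>mu) = (\<integral>y. (\<Sum>a\<in>T. f a * indicator {y \<in> X. q y = a} y) \<partial>mu)"
      proof (rule Bochner_Integration.integral_cong[OF refl])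
        fix y assume "y \<in> space mu"
        then have "y \<in> X" by (simp add: sp)
        then show "f (q y) = (\<Sum>a\<in>T. f a * indicator {y \<in> X. q y = a} y)"
          using T(2) q(1)[of y] by (simp add: indicator_def if_distrib cong: if_cong)
      qed
      also have "\<dots> = (\<Sum>a\<in>T. f a * measure mu {y \<in> X. q y = a})"
        using mqa by (subst Bochner_Integration.integral_sum) (auto simp: sp Int_def mu.emeasure_finite less_top[symmetric] intro!: sum.cong arg_cong[of _ _ "measure mu"])
      finally have i1: "(\<integral>y. f (q y) \<partial>mu) = (\<Sum>a\<in>T. f a * measure mu {y \<in> X. q y = a})" .
      have i2: "(\<Sum>a\<in>T. m a * f a) = (\<integral>y. f (q y) \<partial>mu) + \<delta> * f x0"
        using T(2) x0 by (simp add: i1 m_def distrib_right sum.distrib if_distrib[of "\<lambda>t. t * _"] mult.commute[of "f _"] cong: if_cong)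
      have fq: "integrable mu (\<lambda>y. f (q y))"
      proof (rule mu.integrable_const_bound[of _ B])
        show "(\<lambda>y. f (q y)) \<in> borel_measurable mu" by (rule measurable_compose[OF mq]) simp
        show "AE y in mu. norm (f (q y)) \<le> B" using B q(1) T(1) by (intro AE_I2) (auto simp: sp)
      qed
      have "\<bar>(\<integral>y. f (q y) \<partial>mu) - (\<integral>x. f x \<partial>mu)\<bar> = \<bar>\<integral>y. f (q y) - f y \<partial>mu\<bar>"
        using fq fm by simp
      also have "\<dots> \<le> (\<integral>y. \<bar>f (q y) - f y\<bar> \<partial>mu)" by (rule integral_abs_bound)
      also have "\<dots> \<le> (\<integral>y. e \<partial>mu)"
        using fq fm e q T(1) by (intro integral_mono) (auto simp: sp \<delta>_def subset_iff)
      also have "\<dots> = e * measure mu X" by (simp add: sp mult.commute)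
      finally have "\<bar>(\<integral>y. f (q y) \<partial>mu) - (\<integral>x. f x \<partial>mu)\<bar> \<le> e * measure mu X" .
      moreover have "\<bar>\<delta> * f x0\<bar> \<le> B / real (Suc n)"
        using B x0 T(1) by (auto simp: \<delta>_def abs_mult intro!: divide_right_mono)
      ultimately show "\<bar>(\<Sum>a\<in>T. m a * f a) - (\<integral>x. f x \<partial>mu)\<bar> \<le> e * measure mu X + B / real (Suc n)"
        unfolding i2 by linarith
    qed (use T m ms in auto)
  qed
  then obtain I m where "\<And>n. Q n (I n) (m n)"
    by metis
  then have Im: "\<And>n. finite (I n)" "\<And>n. I n \<subseteq> X" "\<And>n a. (0::real) \<le> m n a" "\<And>n. 0 < sum (m n) (I n)"
    and app: "\<And>n f e B. continuous_on X f \<Longrightarrow> (\<forall>x\<in>X. \<bar>f x\<bar> \<le> B) \<Longrightarrow>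
        (\<forall>x\<in>X. \<forall>y\<in>X. dist x y < 1 / real (Suc n) \<longrightarrow> \<bar>f x - f y\<bar> \<le> e) \<Longrightarrow>
        \<bar>(\<Sum>a\<in>I n. m n a * f a) - (\<integral>x. f x \<partial>mu)\<bar> \<le> e * measure mu X + B / real (Suc n)"
    unfolding Q_def by blast+
  show ?thesis
  proof (intro exI[of _ I] exI[of _ m] conjI allI impI)
    fix f :: "'a \<Rightarrow> real" assume f: "continuous_on X f"
    obtain B where B: "\<forall>x\<in>X. \<bar>f x\<bar> \<le> B"
      using compact_imp_bounded[OF compact_continuous_image[OF f X(1)]] by (auto simp: bounded_iff)
    show "(\<lambda>n. \<Sum>a\<in>I n. m n a * f a) \<longlonglongrightarrow> (\<integral>x. f x \<partial>mu)"
    proof (rule LIMSEQ_I)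
      fix \<eta> :: real assume "\<eta> > 0"
      \<comment> \<open>Adding 1 keeps the divisor positive when \<open>mu\<close> vanishes.\<close>
      define c where "c = measure mu X + 1"
      define e where "e = \<eta> / 2 / c"
      have c: "c > 0" by (simp add: c_def add_nonneg_pos)
      then have e: "e > 0" using \<open>\<eta> > 0\<close> by (simp add: e_def)
      have "e * c = \<eta> / 2" using c by (simp add: e_def)
      then have eX: "e * measure mu X < \<eta> / 2" using e by (simp add: c_def distrib_left)
      obtain d where d: "d > 0" "\<And>x y. x \<in> X \<Longrightarrow> y \<in> X \<Longrightarrow> dist y x < d \<Longrightarrow> dist (f y) (f x) < e"
        using compact_uniformly_continuous[OF f X(1)] e unfolding uniformly_continuous_on_def by blast
      have "\<forall>\<^sub>F n in sequentially. 1 / real (Suc n) < d"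
        using order_tendstoD(2)[OF LIMSEQ_inverse_real_of_nat d(1)] by (simp only: inverse_eq_divide)
      moreover have "\<forall>\<^sub>F n in sequentially. B / real (Suc n) < \<eta> / 2"
        using order_tendstoD(2)[OF tendsto_mult_right_zero[OF LIMSEQ_inverse_real_of_nat, of B], of "\<eta> / 2"]
          half_gt_zero[OF \<open>\<eta> > 0\<close>] by (simp only: divide_inverse)
      ultimately have "\<forall>\<^sub>F n in sequentially. norm ((\<Sum>a\<in>I n. m n a * f a) - (\<integral>x. f x \<partial>mu)) < \<eta>"
      proof eventually_elim
        case (elim n)
        have "\<bar>f x - f y\<bar> \<le> e" if "x \<in> X" "y \<in> X" "dist x y < 1 / real (Suc n)" for x y
          using d(2)[of y x] that elim(1) by (simp add: dist_real_def)
        then have "\<bar>(\<Sum>a\<in>I n. m n a * f a) - (\<integral>x. f x \<partial>mu)\<bar> \<le> e * measure mu X + B / real (Suc n)"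
          using app[OF f B, of n e] by blast
        then show ?case unfolding real_norm_def using eX elim(2) by linarith
      qed
      then show "\<exists>no. \<forall>n\<ge>no. norm ((\<Sum>a\<in>I n. m n a * f a) - (\<integral>x. f x \<partial>mu)) < \<eta>"
        by (simp add: eventually_sequentially)
    qed
  qed (fact Im)+
qed

section \<open>Logit equilibria on a finite grid\<close>

text \<open>The partition function: \<open>\<epsilon>\<close> times its logarithm is the log-sum-exp
  smoothing of the maximum of U - p over the grid.\<close>

definition logit_denom :: "'w set \<Rightarrow> real \<Rightarrow> ('x \<Rightarrow> 'w \<Rightarrow> real) \<Rightarrow> ('w \<Rightarrow> real) \<Rightarrow> 'x \<Rightarrow> real" where
  "logit_denom G \<epsilon> U p i = (\<Sum>k\<in>G. exp ((U i k - p k) / \<epsilon>))"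

definition logit :: "'w set \<Rightarrow> real \<Rightarrow> ('x \<Rightarrow> 'w \<Rightarrow> real) \<Rightarrow> ('w \<Rightarrow> real) \<Rightarrow> 'x \<Rightarrow> 'w \<Rightarrow> real" where
  "logit G \<epsilon> U p i w = exp ((U i w - p w) / \<epsilon>) / logit_denom G \<epsilon> U p i"

text \<open>Demand at w without its own-price factor exp(-p w / eps), so that p enters through the
  denominators alone. The point w may lie off the grid G; this is how a finite grid determines a
  price at every quality.\<close>

definition logit_mass ::
    "'x set \<Rightarrow> ('x \<Rightarrow> real) \<Rightarrow> 'w set \<Rightarrow> real \<Rightarrow> ('x \<Rightarrow> 'w \<Rightarrow> real) \<Rightarrow> ('w \<Rightarrow> real) \<Rightarrow> 'w \<Rightarrow> real" where
  "logit_mass I m G \<epsilon> U p w = (\<Sum>i\<in>I. m i * (exp (U i w / \<epsilon>) / logit_denom G \<epsilon> U p i))"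

lemma sum_logit_eq_mass: "(\<Sum>i\<in>I. m i * logit G \<epsilon> U p i w) = exp (- p w / \<epsilon>) * logit_mass I m G \<epsilon> U p w"
  by (simp add: logit_mass_def logit_def sum_distrib_left diff_divide_distrib exp_diff exp_minus field_simps)

lemma logit_denom_pos: "finite G \<Longrightarrow> G \<noteq> {} \<Longrightarrow> 0 < logit_denom G \<epsilon> U p i"
  unfolding logit_denom_def by (rule sum_pos) auto

lemma logit_nonneg: "finite G \<Longrightarrow> G \<noteq> {} \<Longrightarrow> 0 \<le> logit G \<epsilon> U p i k"
  unfolding logit_def by (intro divide_nonneg_pos logit_denom_pos) auto

lemma sum_logit: "finite G \<Longrightarrow> G \<noteq> {} \<Longrightarrow> (\<Sum>k\<in>G. logit G \<epsilon> U p i k) = 1"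
  using logit_denom_pos[of G \<epsilon> U p i]
  by (simp add: logit_def sum_divide_distrib[symmetric]) (simp add: logit_denom_def)

lemma exp_le_logit_denom: "finite G \<Longrightarrow> k \<in> G \<Longrightarrow> exp ((U i k - p k) / \<epsilon>) \<le> logit_denom G \<epsilon> U p i"
  unfolding logit_denom_def by (rule member_le_sum) auto

text \<open>The option d, worth 0 at price 0, keeps every denominator at least 1, so the upper bound
  is free of M. The lower bound comes from estimating each of the \<open>card G\<close> terms of the
  denominator by exp((C + M) / eps).\<close>

lemma logit_mass_bounds:
  assumes I: "finite I" "\<And>i. i \<in> I \<Longrightarrow> 0 \<le> m i"
    and G: "finite G" "G \<subseteq> W" "d \<in> G" and \<epsilon>: "0 < \<epsilon>"
    and U: "\<And>i w. i \<in> I \<Longrightarrow> w \<in> W \<Longrightarrow> \<bar>U i w\<bar> \<le> C" "\<And>i. i \<in> I \<Longrightarrow> U i d = 0"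
    and p: "p d = 0" "\<And>w. w \<in> W \<Longrightarrow> \<bar>p w\<bar> \<le> M" and w: "w \<in> W"
  shows "sum m I * (exp (- (2 * C + M) / \<epsilon>) / card G) \<le> logit_mass I m G \<epsilon> U p w"
    and "logit_mass I m G \<epsilon> U p w \<le> sum m I * exp (C / \<epsilon>)"
proof -
  have cG: "card G > 0" using G by (auto simp: card_gt_0_iff)
  have D: "1 \<le> logit_denom G \<epsilon> U p i" "logit_denom G \<epsilon> U p i \<le> card G * exp ((C + M) / \<epsilon>)" if i: "i \<in> I" for i
  proof -
    show "1 \<le> logit_denom G \<epsilon> U p i"
      using exp_le_logit_denom[OF G(1,3), of U i p \<epsilon>] U(2)[OF i] p(1) by simp
    have "exp ((U i k - p k) / \<epsilon>) \<le> exp ((C + M) / \<epsilon>)" if "k \<in> G" for k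
    proof -
      have "k \<in> W" using that G(2) by blast
      then have "U i k - p k \<le> C + M" using U(1)[OF i, of k] p(2)[of k] by linarith
      then show ?thesis using \<epsilon> by (simp add: divide_right_mono)
    qed
    then show "logit_denom G \<epsilon> U p i \<le> card G * exp ((C + M) / \<epsilon>)"
      unfolding logit_denom_def
      using sum_bounded_above[of G "\<lambda>k. exp ((U i k - p k) / \<epsilon>)"] by simp
  qed
  have t: "exp (- (2 * C + M) / \<epsilon>) / card G \<le> exp (U i w / \<epsilon>) / logit_denom G \<epsilon> U p i"
    "exp (U i w / \<epsilon>) / logit_denom G \<epsilon> U p i \<le> exp (C / \<epsilon>)" if i: "i \<in> I" for i
  proof -
    have "- (2 * C + M) / \<epsilon> = - C / \<epsilon> - (C + M) / \<epsilon>"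
      by (simp add: add_divide_distrib diff_divide_distrib)
    then have "exp (- (2 * C + M) / \<epsilon>) / card G = exp (- C / \<epsilon>) / (card G * exp ((C + M) / \<epsilon>))"
      by (simp only: exp_diff) simp
    also have "\<dots> \<le> exp (U i w / \<epsilon>) / logit_denom G \<epsilon> U p i"
    proof (rule frac_le)
      show "exp (- C / \<epsilon>) \<le> exp (U i w / \<epsilon>)"
        using U(1)[OF i w] \<epsilon> by (subst exp_le_cancel_iff, intro divide_right_mono) auto
    qed (use D[OF i] in auto)
    finally show "exp (- (2 * C + M) / \<epsilon>) / card G \<le> exp (U i w / \<epsilon>) / logit_denom G \<epsilon> U p i" .
    have "exp (U i w / \<epsilon>) / logit_denom G \<epsilon> U p i \<le> exp (C / \<epsilon>) / 1"
    proof (rule frac_le)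
      show "exp (U i w / \<epsilon>) \<le> exp (C / \<epsilon>)"
        using U(1)[OF i w] \<epsilon> by (subst exp_le_cancel_iff, intro divide_right_mono) auto
    qed (use D[OF i] in auto)
    then show "exp (U i w / \<epsilon>) / logit_denom G \<epsilon> U p i \<le> exp (C / \<epsilon>)" by simp
  qed
  show "sum m I * (exp (- (2 * C + M) / \<epsilon>) / card G) \<le> logit_mass I m G \<epsilon> U p w"
    unfolding logit_mass_def sum_distrib_right by (intro sum_mono mult_left_mono t I)
  show "logit_mass I m G \<epsilon> U p w \<le> sum m I * exp (C / \<epsilon>)"
    unfolding logit_mass_def sum_distrib_right by (intro sum_mono mult_left_mono t I)
qed

lemma ln_logit_mass_bounds:
  assumes I: "finite I" "\<And>i. i \<in> I \<Longrightarrow> 0 \<le> m i" "0 < sum m I"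
    and G: "finite G" "G \<subseteq> W" "d \<in> G" and \<epsilon>: "0 < \<epsilon>"
    and U: "\<And>i w. i \<in> I \<Longrightarrow> w \<in> W \<Longrightarrow> \<bar>U i w\<bar> \<le> C" "\<And>i. i \<in> I \<Longrightarrow> U i d = 0"
    and p: "p d = 0" "\<And>w. w \<in> W \<Longrightarrow> \<bar>p w\<bar> \<le> M" and w: "w \<in> W"
  shows "0 < logit_mass I m G \<epsilon> U p w"
    and "ln (sum m I) - (2 * C + M) / \<epsilon> - ln (card G) \<le> ln (logit_mass I m G \<epsilon> U p w)"
    and "ln (logit_mass I m G \<epsilon> U p w) \<le> ln (sum m I) + C / \<epsilon>"
proof -
  note b = logit_mass_bounds[of I m G W d \<epsilon> U C p M w, OF I(1,2) G \<epsilon> U p w]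
  have cG: "card G > 0" using G by (auto simp: card_gt_0_iff)
  have low: "0 < sum m I * (exp (- (2 * C + M) / \<epsilon>) / card G)" using I(3) cG by simp
  with b(1) show pos: "0 < logit_mass I m G \<epsilon> U p w" by linarith
  have "ln (sum m I * (exp (- (2 * C + M) / \<epsilon>) / card G)) \<le> ln (logit_mass I m G \<epsilon> U p w)"
    using low b(1) pos by simp
  also have "ln (sum m I * (exp (- (2 * C + M) / \<epsilon>) / card G)) = ln (sum m I) - (2 * C + M) / \<epsilon> - ln (card G)"
    using I(3) cG by (simp add: ln_mult ln_div add_divide_distrib diff_divide_distrib)
  finally show "ln (sum m I) - (2 * C + M) / \<epsilon> - ln (card G) \<le> ln (logit_mass I m G \<epsilon> U p w)" .
  have "ln (logit_mass I m G \<epsilon> U p w) \<le> ln (sum m I * exp (C / \<epsilon>))"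
    using b(2) pos I(3) by simp
  then show "ln (logit_mass I m G \<epsilon> U p w) \<le> ln (sum m I) + C / \<epsilon>"
    using I(3) by (simp add: ln_mult)
qed

text \<open>Higher prices shrink every denominator, and nothing else in the mass depends on the
  price.\<close>

lemma logit_mass_mono:
  assumes I: "\<And>i. i \<in> I \<Longrightarrow> 0 \<le> m i" and G: "finite G" "G \<noteq> {}" and \<epsilon>: "0 < \<epsilon>"
    and p: "\<And>k. k \<in> G \<Longrightarrow> p k \<le> q k"
  shows "logit_mass I m G \<epsilon> U p w \<le> logit_mass I m G \<epsilon> U q w"
  unfolding logit_mass_def
proof (intro sum_mono mult_left_mono I divide_left_mono)
  fix i
  show "logit_denom G \<epsilon> U q i \<le> logit_denom G \<epsilon> U p i"
    unfolding logit_denom_def using p \<epsilon> by (intro sum_mono) (simp add: divide_right_mono)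
  show "0 < logit_denom G \<epsilon> U p i * logit_denom G \<epsilon> U q i"
    by (intro mult_pos_pos logit_denom_pos G)
qed auto

text \<open>Moving from w to w' changes only the numerators, by a factor of at most exp(delta /
  eps), as the denominators do not see w. Multiplied by eps, the estimate depends neither on the
  noise nor on the grid.\<close>

lemma logit_mass_oscillation:
  assumes I: "\<And>i. i \<in> I \<Longrightarrow> 0 \<le> m i" and G: "finite G" "G \<noteq> {}" and \<epsilon>: "0 < \<epsilon>"
    and \<delta>: "\<And>i. i \<in> I \<Longrightarrow> U i w \<le> U i w' + \<delta>" and pos: "0 < logit_mass I m G \<epsilon> U p w" "0 < logit_mass I m G \<epsilon> U p w'"
  shows "ln (logit_mass I m G \<epsilon> U p w) \<le> ln (logit_mass I m G \<epsilon> U p w') + \<delta> / \<epsilon>"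
proof -
  have "logit_mass I m G \<epsilon> U p w \<le> (\<Sum>i\<in>I. m i * (exp ((U i w' + \<delta>) / \<epsilon>) / logit_denom G \<epsilon> U p i))"
    unfolding logit_mass_def using \<epsilon> \<delta> logit_denom_pos[OF G, of \<epsilon> U p]
    by (intro sum_mono mult_left_mono I divide_right_mono) (auto simp: less_imp_le divide_right_mono)
  also have "\<dots> = logit_mass I m G \<epsilon> U p w' * exp (\<delta> / \<epsilon>)"
    by (simp add: logit_mass_def sum_distrib_right add_divide_distrib exp_add mult.assoc)
  finally have "ln (logit_mass I m G \<epsilon> U p w) \<le> ln (logit_mass I m G \<epsilon> U p w' * exp (\<delta> / \<epsilon>))"
    using pos by simp
  then show ?thesis using pos by (simp add: ln_mult)
qed

lemma tendsto_logit_mass: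
  assumes "finite G" "G \<noteq> {}" "\<And>k. k \<in> G \<Longrightarrow> (\<lambda>n. q n k) \<longlonglongrightarrow> p k" "0 < \<epsilon>"
  shows "(\<lambda>n. logit_mass I m G \<epsilon> U (q n) w) \<longlonglongrightarrow> logit_mass I m G \<epsilon> U p w"
proof -
  have "(\<lambda>n. logit_denom G \<epsilon> U (q n) i) \<longlonglongrightarrow> logit_denom G \<epsilon> U p i" for i
    unfolding logit_denom_def using assms by (intro tendsto_intros) auto
  then show ?thesis
    unfolding logit_mass_def using logit_denom_pos[OF assms(1,2), of \<epsilon> U p]
    by (intro tendsto_intros) (auto simp: less_imp_neq[symmetric])
qed

text \<open>Iterates started at the least element increase and are bounded, hence converge
  pointwise, and \<open>cont\<close> identifies the limit as a fixed point. Order and convergence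
  are demanded on W alone, because the functions are arbitrary elsewhere.\<close>

lemma monotone_bounded_fixed_point:
  fixes F :: "('w \<Rightarrow> real) \<Rightarrow> 'w \<Rightarrow> real"
  assumes maps: "\<And>p. p \<in> Q \<Longrightarrow> F p \<in> Q"
    and mono: "\<And>p q w. p \<in> Q \<Longrightarrow> q \<in> Q \<Longrightarrow> (\<And>k. k \<in> W \<Longrightarrow> p k \<le> q k) \<Longrightarrow> w \<in> W \<Longrightarrow> F p w \<le> F q w"
    and cont: "\<And>q p w. (\<And>n. q n \<in> Q) \<Longrightarrow> p \<in> Q \<Longrightarrow> (\<And>k. k \<in> W \<Longrightarrow> (\<lambda>n. q n k) \<longlonglongrightarrow> p k) \<Longrightarrow> w \<in> W
        \<Longrightarrow> (\<lambda>n. F (q n) w) \<longlonglongrightarrow> F p w"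
    and closed: "\<And>q p. (\<And>n. q n \<in> Q) \<Longrightarrow> (\<And>k. k \<in> W \<Longrightarrow> (\<lambda>n. q n k) \<longlonglongrightarrow> p k) \<Longrightarrow> p \<in> Q"
    and least: "q0 \<in> Q" "\<And>p w. p \<in> Q \<Longrightarrow> w \<in> W \<Longrightarrow> q0 w \<le> p w"
    and bound: "\<And>p w. p \<in> Q \<Longrightarrow> w \<in> W \<Longrightarrow> p w \<le> M"
  obtains p where "p \<in> Q" "\<And>w. w \<in> W \<Longrightarrow> F p w = p w"
proof -
  define q where "q n = (F ^^ n) q0" for n
  have qS: "q (Suc n) = F (q n)" for n by (simp add: q_def)
  have qQ: "q n \<in> Q" for n
    by (induction n) (use least(1) maps in \<open>auto simp: q_def\<close>)
  have inc: "q n w \<le> q (Suc n) w" if "w \<in> W" for n w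
    using that
  proof (induction n arbitrary: w)
    case 0
    then show ?case using least(2)[OF qQ[of 1]] by (simp add: q_def)
  next
    case (Suc n)
    then show ?case unfolding qS[of "Suc n"] qS[of n] using mono[OF qQ qQ] by (metis qS)
  qed
  define p where "p w = lim (\<lambda>n. q n w)" for w
  have lim: "(\<lambda>n. q n w) \<longlonglongrightarrow> p w" if w: "w \<in> W" for w
  proof -
    have "incseq (\<lambda>n. q n w)" using inc[OF w] by (rule incseq_SucI)
    moreover have "\<forall>n. q n w \<le> M" using bound[OF qQ w] by blast
    ultimately obtain L where "(\<lambda>n. q n w) \<longlonglongrightarrow> L" using incseq_convergent by blast
    then show ?thesis unfolding p_def using limI by metis
  qed
  have pQ: "p \<in> Q" using closed[OF qQ lim] .
  have "F p w = p w" if w: "w \<in> W" for w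
  proof (rule LIMSEQ_unique)
    show "(\<lambda>n. q (Suc n) w) \<longlonglongrightarrow> F p w" unfolding qS by (rule cont[OF qQ pQ lim w])
    show "(\<lambda>n. q (Suc n) w) \<longlonglongrightarrow> p w" using lim[OF w] by (rule LIMSEQ_Suc)
  qed
  with pQ show thesis by (rule that)
qed

text \<open>Clearing is claimed everywhere except at d and s, whose prices stay 0; there the
  difference between \<open>sum m I\<close> and \<open>sum n J\<close> is absorbed. The bound
  \<open>eps\<close> limits to 1 what the grid size and the mass ratio contribute to eps * |ln A -
  ln B|.\<close>

theorem logit_equilibrium:
  fixes U :: "'x \<Rightarrow> 'w \<Rightarrow> real" and V :: "'y \<Rightarrow> 'w \<Rightarrow> real"
  assumes I: "finite I" "\<And>i. i \<in> I \<Longrightarrow> 0 \<le> m i" "0 < sum m I"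
    and J: "finite J" "\<And>j. j \<in> J \<Longrightarrow> 0 \<le> n j" "0 < sum n J"
    and G: "finite G" "G \<subseteq> W" "d \<in> G" "s \<in> G" and \<epsilon>: "0 < \<epsilon>"
    and U: "\<And>i w. i \<in> I \<Longrightarrow> w \<in> W \<Longrightarrow> \<bar>U i w\<bar> \<le> C" "\<And>i. i \<in> I \<Longrightarrow> U i d = 0"
    and V: "\<And>j w. j \<in> J \<Longrightarrow> w \<in> W \<Longrightarrow> \<bar>V j w\<bar> \<le> C" "\<And>j. j \<in> J \<Longrightarrow> V j s = 0"
    and eps: "\<epsilon> * (ln (card G) + \<bar>ln (sum m I) - ln (sum n J)\<bar>) \<le> 1"
  obtains p where "p d = 0" "p s = 0" "\<And>w. w \<in> W \<Longrightarrow> \<bar>p w\<bar> \<le> 3 * C + 1"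
    "\<And>w. w \<in> W - {d, s} \<Longrightarrow>
      (\<Sum>i\<in>I. m i * logit G \<epsilon> U p i w) = (\<Sum>j\<in>J. n j * logit G \<epsilon> V (\<lambda>w. - p w) j w)"
    "\<And>w w' \<delta>. w \<in> W - {d, s} \<Longrightarrow> w' \<in> W - {d, s} \<Longrightarrow> (\<And>i. i \<in> I \<Longrightarrow> \<bar>U i w - U i w'\<bar> \<le> \<delta>) \<Longrightarrow>
      (\<And>j. j \<in> J \<Longrightarrow> \<bar>V j w - V j w'\<bar> \<le> \<delta>) \<Longrightarrow> \<bar>p w - p w'\<bar> \<le> \<delta>"
proof -
  \<comment> \<open>The solution of (1 + 3 * C + M) / 2 = M, so that F maps the box of radius M into
    itself.\<close>
  define M where "M = 3 * C + 1"
  obtain i0 where "i0 \<in> I" using I(3) by fastforce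
  then have C: "C \<ge> 0" using U(1)[of i0 d] G by fastforce
  then have M: "M \<ge> 0" by (simp add: M_def)
  have Gne: "G \<noteq> {}" using G by auto
  define Q where "Q = {p :: 'w \<Rightarrow> real. p d = 0 \<and> p s = 0 \<and> (\<forall>w\<in>W. \<bar>p w\<bar> \<le> M)}"
  define A where "A p w = logit_mass I m G \<epsilon> U p w" for p w
  \<comment> \<open>Supply is logit demand for the negated supply function, here called
    \<open>V\<close>, at the price -p. This makes B decreasing in p, hence F increasing.\<close>
  define B where "B p w = logit_mass J n G \<epsilon> V (\<lambda>w. - p w) w" for p w
  define F where "F p w = (if w = d \<or> w = s then 0 else \<epsilon> / 2 * (ln (A p w) - ln (B p w)))" for p w
  have Ab: "0 < A p w" "ln (sum m I) - (2 * C + M) / \<epsilon> - ln (card G) \<le> ln (A p w)" "ln (A p w) \<le> ln (sum m I) + C / \<epsilon>"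
    if "p \<in> Q" "w \<in> W" for p w
    using ln_logit_mass_bounds[of I m G W d \<epsilon> U C p M w] I G \<epsilon> U that by (auto simp: A_def Q_def)
  have Bb: "0 < B p w" "ln (sum n J) - (2 * C + M) / \<epsilon> - ln (card G) \<le> ln (B p w)" "ln (B p w) \<le> ln (sum n J) + C / \<epsilon>"
    if "p \<in> Q" "w \<in> W" for p w
    using ln_logit_mass_bounds[of J n G W s \<epsilon> V C "\<lambda>w. - p w" M w] J G \<epsilon> V that by (auto simp: B_def Q_def)
  have maps: "F p \<in> Q" if p: "p \<in> Q" for p
  proof -
    have "\<bar>F p w\<bar> \<le> M" if w: "w \<in> W" for w
    proof (cases "w = d \<or> w = s")
      case False
      have "ln (A p w) - ln (B p w) \<le> ln (card G) + \<bar>ln (sum m I) - ln (sum n J)\<bar> + (3 * C + M) / \<epsilon>"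
        "- (ln (A p w) - ln (B p w)) \<le> ln (card G) + \<bar>ln (sum m I) - ln (sum n J)\<bar> + (3 * C + M) / \<epsilon>"
        using Ab(2,3)[OF p w] Bb(2,3)[OF p w] by (auto simp: add_divide_distrib)
      then have "\<bar>ln (A p w) - ln (B p w)\<bar> \<le> ln (card G) + \<bar>ln (sum m I) - ln (sum n J)\<bar> + (3 * C + M) / \<epsilon>"
        by linarith
      then have "\<epsilon> * \<bar>ln (A p w) - ln (B p w)\<bar> \<le> \<epsilon> * (ln (card G) + \<bar>ln (sum m I) - ln (sum n J)\<bar> + (3 * C + M) / \<epsilon>)"
        using \<epsilon> by simp
      also have "\<dots> = \<epsilon> * (ln (card G) + \<bar>ln (sum m I) - ln (sum n J)\<bar>) + (3 * C + M)"
        using \<epsilon> by (subst distrib_left) simp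
      also have "\<dots> \<le> 1 + (3 * C + M)"
        using eps by simp
      also have "\<dots> = 2 * M" by (simp add: M_def)
      finally show ?thesis using False \<epsilon> by (simp add: F_def abs_mult)
    qed (use M in \<open>auto simp: F_def\<close>)
    then show ?thesis by (simp add: Q_def F_def)
  qed
  obtain p where p: "p \<in> Q" "\<And>w. w \<in> W \<Longrightarrow> F p w = p w"
  proof (rule monotone_bounded_fixed_point[of Q F W "\<lambda>w. if w = d \<or> w = s then 0 else - M" M])
    fix p q :: "'w \<Rightarrow> real" and w assume p: "p \<in> Q" and q: "q \<in> Q" and le: "\<And>k. k \<in> W \<Longrightarrow> p k \<le> q k" and w: "w \<in> W"
    have "A p w \<le> A q w" unfolding A_def
      by (rule logit_mass_mono[OF I(2) G(1) Gne \<epsilon>]) (use le G in auto)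
    moreover have "B q w \<le> B p w" unfolding B_def
      by (rule logit_mass_mono[OF J(2) G(1) Gne \<epsilon>]) (use le G in auto)
    ultimately have "ln (A p w) - ln (B p w) \<le> ln (A q w) - ln (B q w)"
      using Ab(1)[OF p w] Ab(1)[OF q w] Bb(1)[OF p w] Bb(1)[OF q w] by (intro diff_mono) auto
    then show "F p w \<le> F q w" using \<epsilon> by (simp add: F_def)
  next
    fix q :: "nat \<Rightarrow> 'w \<Rightarrow> real" and p w
    assume q: "\<And>n. q n \<in> Q" and p: "p \<in> Q" and lim: "\<And>k. k \<in> W \<Longrightarrow> (\<lambda>n. q n k) \<longlonglongrightarrow> p k" and w: "w \<in> W"
    have "(\<lambda>n. A (q n) w) \<longlonglongrightarrow> A p w" "(\<lambda>n. B (q n) w) \<longlonglongrightarrow> B p w"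
      unfolding A_def B_def
      by (intro tendsto_logit_mass G(1) Gne \<epsilon> tendsto_minus lim; use G in auto)+
    then have "(\<lambda>n. \<epsilon> / 2 * (ln (A (q n) w) - ln (B (q n) w))) \<longlonglongrightarrow> \<epsilon> / 2 * (ln (A p w) - ln (B p w))"
      using Ab(1)[OF p w] Bb(1)[OF p w] by (intro tendsto_intros) auto
    then show "(\<lambda>n. F (q n) w) \<longlonglongrightarrow> F p w" by (simp add: F_def)
  next
    fix q :: "nat \<Rightarrow> 'w \<Rightarrow> real" and p
    assume q: "\<And>n. q n \<in> Q" and lim: "\<And>k. k \<in> W \<Longrightarrow> (\<lambda>n. q n k) \<longlonglongrightarrow> p k"
    have "\<bar>p w\<bar> \<le> M" if "w \<in> W" for w
      using tendsto_rabs[OF lim[OF that]] q that by (intro LIMSEQ_le_const2) (auto simp: Q_def)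
    moreover have "d \<in> W" "s \<in> W" using G by auto
    then have "p d = 0" "p s = 0"
      using lim[of d] lim[of s] q by (simp_all add: Q_def LIMSEQ_const_iff)
    ultimately show "p \<in> Q" by (simp add: Q_def)
  next
    fix p :: "'w \<Rightarrow> real" and w assume "p \<in> Q" "w \<in> W"
    then show "p w \<le> M" "(if w = d \<or> w = s then 0 else - M) \<le> p w"
      by (auto simp: Q_def abs_le_iff)
  qed (use maps M in \<open>auto simp: Q_def\<close>)
  have fp: "2 * p w / \<epsilon> = ln (A p w) - ln (B p w)" if "w \<in> W - {d, s}" for w
    using p(2)[of w] that \<epsilon> by (auto simp: F_def field_simps)
  show thesis
  proof (rule that[of p])
    show "p d = 0" "p s = 0" "\<And>w. w \<in> W \<Longrightarrow> \<bar>p w\<bar> \<le> 3 * C + 1"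
      using p(1) by (auto simp: Q_def M_def)
    fix w assume w: "w \<in> W - {d, s}"
    have "exp (- p w / \<epsilon>) * A p w = exp (ln (A p w) - p w / \<epsilon>)"
      using Ab(1)[OF p(1)] w by (simp add: exp_diff exp_minus field_simps)
    also have "ln (A p w) - p w / \<epsilon> = ln (B p w) + p w / \<epsilon>"
      using fp[OF w] by simp
    also have "exp (ln (B p w) + p w / \<epsilon>) = exp (p w / \<epsilon>) * B p w"
      using Bb(1)[OF p(1)] w by (simp add: exp_add)
    finally show "(\<Sum>i\<in>I. m i * logit G \<epsilon> U p i w) = (\<Sum>j\<in>J. n j * logit G \<epsilon> V (\<lambda>w. - p w) j w)"
      by (simp add: sum_logit_eq_mass A_def B_def)
  next
    \<comment> \<open>The two logarithms each move by at most delta / eps, with opposite orientation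
      because ln B is subtracted. Their sum 2 * delta / eps is matched by the factor 2 in
      \<open>fp\<close>, so p itself moves by at most delta.\<close>
    have half: "p w \<le> p w' + \<delta>"
      if w: "w \<in> W - {d, s}" "w' \<in> W - {d, s}" and u: "\<And>i. i \<in> I \<Longrightarrow> U i w \<le> U i w' + \<delta>"
        and v: "\<And>j. j \<in> J \<Longrightarrow> V j w' \<le> V j w + \<delta>" for w w' \<delta>
    proof -
      have "ln (A p w) \<le> ln (A p w') + \<delta> / \<epsilon>" unfolding A_def
        using w Ab(1)[OF p(1)] by (intro logit_mass_oscillation I(2) G(1) Gne \<epsilon> u) (auto simp: A_def)
      moreover have "ln (B p w') \<le> ln (B p w) + \<delta> / \<epsilon>" unfolding B_def
        using w Bb(1)[OF p(1)] by (intro logit_mass_oscillation J(2) G(1) Gne \<epsilon> v) (auto simp: B_def)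
      ultimately have "2 * p w / \<epsilon> \<le> 2 * p w' / \<epsilon> + 2 * (\<delta> / \<epsilon>)"
        unfolding fp[OF w(1)] fp[OF w(2)] by linarith
      then have "2 * p w / \<epsilon> \<le> (2 * (p w' + \<delta>)) / \<epsilon>" by (simp add: add_divide_distrib)
      then show ?thesis using \<epsilon> by (simp add: divide_le_cancel)
    qed
    fix w w' \<delta> assume w: "w \<in> W - {d, s}" "w' \<in> W - {d, s}"
      and u: "\<And>i. i \<in> I \<Longrightarrow> \<bar>U i w - U i w'\<bar> \<le> \<delta>" and v: "\<And>j. j \<in> J \<Longrightarrow> \<bar>V j w - V j w'\<bar> \<le> \<delta>"
    have "p w \<le> p w' + \<delta>" using w u v by (intro half) (fastforce simp: abs_le_iff)+
    moreover have "p w' \<le> p w + \<delta>" using w u v by (intro half) (fastforce simp: abs_le_iff)+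
    ultimately show "\<bar>p w - p w'\<bar> \<le> \<delta>" by linarith
  qed
qed

section \<open>The zero-noise limit of logit demand\<close>

lemma integrable_continuous_on_compact:
  fixes f :: "'a::euclidean_space \<Rightarrow> real"
  assumes K: "compact K" and M: "finite_measure M" "sets M = sets (restrict_space borel K)"
    and f: "continuous_on K f"
  shows "integrable M f"
proof -
  have sp: "space M = K" using sets_eq_imp_space_eq[OF M(2)] by (simp add: space_restrict_space)
  obtain B where "\<forall>x\<in>K. norm (f x) \<le> B"
    using compact_imp_bounded[OF compact_continuous_image[OF f K]] by (auto simp: bounded_iff)
  moreover have "f \<in> borel_measurable M"
    using borel_measurable_continuous_on_restrict[OF f] measurable_cong_sets[OF M(2) refl] by blast
  ultimately show ?thesis
    by (intro finite_measure.integrable_const_bound[OF M(1), of _ B] AE_I2) (auto simp: sp)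
qed

lemma bdd_above_continuous_image:
  fixes f :: "'a::topological_space \<Rightarrow> real"
  assumes "compact K" "continuous_on K f"
  shows "bdd_above (f ` K)"
  by (intro bounded_imp_bdd_above compact_imp_bounded compact_continuous_image assms)

text \<open>Uniform continuity on the product makes the modulus in a independent of k, and suprema
  inherit it.\<close>

lemma continuous_on_SUP_compact:
  fixes f :: "'a::metric_space \<Rightarrow> 'b::metric_space \<Rightarrow> real"
  assumes A: "compact A" and K: "compact K" "K \<noteq> {}"
    and f: "continuous_on (A \<times> K) (\<lambda>(a, k). f a k)"
  shows "continuous_on A (\<lambda>a. SUP k\<in>K. f a k)"
  unfolding continuous_on_iff
proof (intro ballI allI impI)
  fix a and e :: real assume a: "a \<in> A" and e: "0 < e"
  have "uniformly_continuous_on (A \<times> K) (\<lambda>(a, k). f a k)"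
    by (intro compact_uniformly_continuous f compact_Times A K(1))
  then obtain d where d: "d > 0"
    "\<And>z z'. z \<in> A \<times> K \<Longrightarrow> z' \<in> A \<times> K \<Longrightarrow> dist z' z < d \<Longrightarrow> dist (case z' of (a, k) \<Rightarrow> f a k) (case z of (a, k) \<Rightarrow> f a k) < e / 2"
    unfolding uniformly_continuous_on_def using half_gt_zero[OF e] by blast
  have close: "\<bar>f a' k - f a'' k\<bar> < e / 2" if "a' \<in> A" "a'' \<in> A" "k \<in> K" "dist a' a'' < d" for a' a'' k
    using d(2)[of "(a'', k)" "(a', k)"] that by (simp add: dist_Pair_Pair dist_real_def)
  have bdd: "bdd_above ((\<lambda>k. f a k) ` K)" if "a \<in> A" for a
  proof (rule bdd_above_continuous_image[OF K(1)])
    have "continuous_on K (\<lambda>k. case (a, k) of (a, k) \<Rightarrow> f a k)"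
      by (rule continuous_on_compose2[OF f]) (use that in \<open>auto intro!: continuous_intros\<close>)
    then show "continuous_on K (\<lambda>k. f a k)" by simp
  qed
  have half: "(SUP k\<in>K. f a' k) \<le> (SUP k\<in>K. f a'' k) + e / 2" if "a' \<in> A" "a'' \<in> A" "dist a' a'' < d" for a' a''
  proof (rule cSUP_least[OF K(2)])
    fix k assume k: "k \<in> K"
    have "f a'' k \<le> (SUP k\<in>K. f a'' k)" by (rule cSUP_upper[OF k bdd]) fact
    then show "f a' k \<le> (SUP k\<in>K. f a'' k) + e / 2" using close[OF that(1,2) k that(3)] by linarith
  qed
  show "\<exists>d>0. \<forall>a'\<in>A. dist a' a < d \<longrightarrow> dist (SUP k\<in>K. f a' k) (SUP k\<in>K. f a k) < e"
  proof (intro exI[of _ d] conjI d(1) ballI impI)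
    fix a' assume a': "a' \<in> A" "dist a' a < d"
    then show "dist (SUP k\<in>K. f a' k) (SUP k\<in>K. f a k) < e"
      using half[of a' a] half[of a a'] a e by (simp add: dist_real_def dist_commute abs_less_iff)
  qed
qed

lemma measurable_fst_restrict_Times:
  "fst \<in> measurable (restrict_space borel (X \<times> W)) (restrict_space borel (X :: 'a::topological_space set))"
  by (intro measurable_restrict_space2 borel_measurable_continuous_on_restrict continuous_intros)
    (auto simp: space_restrict_space)

lemma measurable_snd_restrict_Times:
  "snd \<in> measurable (restrict_space borel (X \<times> W)) (restrict_space borel (W :: 'a::topological_space set))"
  by (intro measurable_restrict_space2 borel_measurable_continuous_on_restrict continuous_intros)
    (auto simp: space_restrict_space)

text \<open>The shortfall equals eps * t where the choice probability is exp(-t), and t * exp(-t) <=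
  1: bad options are chosen so rarely that their contribution to the expected loss stays below
  eps.\<close>

lemma logit_mult_gap_le:
  assumes "finite G" "k \<in> G" "0 < \<epsilon>"
    and H: "H = \<epsilon> * ln (logit_denom G \<epsilon> U p i)"
  shows "logit G \<epsilon> U p i k * (H - (U i k - p k)) \<le> \<epsilon>"
proof -
  define t where "t = (H - (U i k - p k)) / \<epsilon>"
  have D: "logit_denom G \<epsilon> U p i > 0" using assms by (intro logit_denom_pos) auto
  have "exp ((U i k - p k) / \<epsilon>) / logit_denom G \<epsilon> U p i = exp ((U i k - p k) / \<epsilon> - ln (logit_denom G \<epsilon> U p i))"
    using D by (simp add: exp_diff)
  also have "(U i k - p k) / \<epsilon> - ln (logit_denom G \<epsilon> U p i) = - t"
    using \<open>0 < \<epsilon>\<close> by (simp add: t_def H diff_divide_distrib)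
  finally have "logit G \<epsilon> U p i k = exp (- t)" by (simp add: logit_def)
  moreover have "t \<le> exp t" using exp_ge_add_one_self[of t] by linarith
  then have "t * exp (- t) \<le> 1" by (simp add: exp_minus field_simps)
  moreover have "H - (U i k - p k) = \<epsilon> * t" using \<open>0 < \<epsilon>\<close> by (simp add: t_def)
  ultimately show ?thesis using \<open>0 < \<epsilon>\<close>
    by (simp add: mult.left_commute mult.commute)
qed

text \<open>Concentration on the argmax graph is reduced to one number: the shortfall
  \<open>gap\<close> is continuous, nonnegative and zero exactly on that graph, so its integral has
  to vanish. In the final limit formula the quality is the outer summation index, because clearing
  is known quality by quality.\<close>

theorem logit_demand_limit:
  fixes U :: "'x::euclidean_space \<Rightarrow> 'w::euclidean_space \<Rightarrow> real"
  assumes X: "compact X" and W: "compact W" "W \<noteq> {}"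
    and mu: "finite_measure mu" "sets mu = sets (restrict_space borel X)"
    and U: "continuous_on (X \<times> W) (\<lambda>(x, w). U x w)"
    and p: "continuous_on W p"
    and unif: "\<And>e. e > 0 \<Longrightarrow> \<exists>N. \<forall>n\<ge>N. \<forall>w\<in>W. \<bar>P n w - p w\<bar> < e"
    and I: "\<And>n. finite (I n)" "\<And>n. I n \<subseteq> X" "\<And>n i. 0 \<le> m n i" "\<And>n. 0 < sum (m n) (I n)"
    and m: "\<And>f. continuous_on X f \<Longrightarrow> (\<lambda>n. \<Sum>i\<in>I n. m n i * f i) \<longlonglongrightarrow> (\<integral>x. f x \<partial>mu)"
    and G: "\<And>n. finite (G n)" "\<And>n. G n \<subseteq> W" "\<And>n. G n \<noteq> {}"
    and dense: "\<And>\<delta>. \<delta> > 0 \<Longrightarrow> \<exists>N. \<forall>n\<ge>N. \<forall>w\<in>W. \<exists>k\<in>G n. dist w k < \<delta>"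
    and \<epsilon>: "\<And>n. 0 < \<epsilon> n" "(\<lambda>n. real (card (G n)) * \<epsilon> n) \<longlonglongrightarrow> 0"
  obtains r \<alpha> where "strict_mono r" "finite_measure \<alpha>" "sets \<alpha> = sets (restrict_space borel (X \<times> W))"
    "AE xw in \<alpha>. snd xw \<in> W \<and> (\<forall>w'\<in>W. U (fst xw) w' - p w' \<le> U (fst xw) (snd xw) - p (snd xw))"
    "distr \<alpha> (restrict_space borel X) fst = mu"
    "\<And>f. continuous_on (X \<times> W) f \<Longrightarrow>
       (\<lambda>n. \<Sum>k\<in>G (r n). \<Sum>i\<in>I (r n). m (r n) i * logit (G (r n)) (\<epsilon> (r n)) U (P (r n)) i k * f (i, k))
         \<longlonglongrightarrow> (\<integral>xw. f xw \<partial>\<alpha>)"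
proof -
  have spX: "space mu = X" using sets_eq_imp_space_eq[OF mu(2)] by (simp add: space_restrict_space)
  define a where "a n = (\<lambda>(i, k). m n i * logit (G n) (\<epsilon> n) U (P n) i k)" for n
  have a_nonneg: "0 \<le> a n z" for n z
    using I(3) logit_nonneg[OF G(1,3)] by (auto simp: a_def split: prod.split intro!: mult_nonneg_nonneg)
  have marg: "(\<Sum>z\<in>I n \<times> G n. a n z * f (fst z)) = (\<Sum>i\<in>I n. m n i * f i)" for f :: "'x \<Rightarrow> real" and n
  proof -
    have "(\<Sum>z\<in>I n \<times> G n. a n z * f (fst z)) = (\<Sum>i\<in>I n. \<Sum>k\<in>G n. m n i * f i * logit (G n) (\<epsilon> n) U (P n) i k)"
      by (simp add: a_def sum.cartesian_product case_prod_unfold mult_ac)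
    also have "\<dots> = (\<Sum>i\<in>I n. m n i * f i)"
      using G by (simp add: sum_logit flip: sum_distrib_left)
    finally show ?thesis .
  qed
  have sum_a: "sum (a n) (I n \<times> G n) = sum (m n) (I n)" for n
    using marg[of n "\<lambda>_. 1"] by simp
  have mass: "(\<lambda>n. sum (m n) (I n)) \<longlonglongrightarrow> measure mu X"
    using m[of "\<lambda>_. 1"] by (simp add: spX)
  obtain r \<alpha> where r: "strict_mono r" and fin\<alpha>: "finite_measure \<alpha>" and sets\<alpha>: "sets \<alpha> = sets (restrict_space borel (X \<times> W))"
    and lim: "\<And>f::_ \<Rightarrow> real. continuous_on (X \<times> W) f \<Longrightarrow>
       (\<lambda>n. \<Sum>z\<in>I (r n) \<times> G (r n). a (r n) z * f z) \<longlonglongrightarrow> (\<integral>z. f z \<partial>\<alpha>)"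
  proof (rule finitely_supported_weak_limit[of "X \<times> W" "\<lambda>n. I n \<times> G n" a "measure mu X"])
    show "compact (X \<times> W)" using X W(1) by (rule compact_Times)
    show "\<And>n. I n \<times> G n \<subseteq> X \<times> W" using I(2) G(2) by blast
  qed (use I G a_nonneg sum_a mass in auto)
  have sp\<alpha>: "space \<alpha> = X \<times> W" using sets_eq_imp_space_eq[OF sets\<alpha>] by (simp add: space_restrict_space)
  have mfst: "fst \<in> measurable \<alpha> (restrict_space borel X)"
    using measurable_fst_restrict_Times measurable_cong_sets[OF sets\<alpha> refl] by blast
  have distr: "distr \<alpha> (restrict_space borel X) fst = mu"
  proof (rule finite_measure_eqI_continuous[OF X _ _ mu])
    show "finite_measure (distr \<alpha> (restrict_space borel X) fst)"
      using fin\<alpha> mfst by (rule finite_measure.finite_measure_distr)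
    fix f :: "'x \<Rightarrow> real" assume f: "continuous_on X f"
    have cf: "continuous_on (X \<times> W) (\<lambda>z. f (fst z))"
      by (rule continuous_on_compose2[OF f]) (auto intro: continuous_intros)
    have "(\<integral>x. f x \<partial>distr \<alpha> (restrict_space borel X) fst) = (\<integral>z. f (fst z) \<partial>\<alpha>)"
      by (rule integral_distr[OF mfst borel_measurable_continuous_on_restrict[OF f]])
    also have "\<dots> = (\<integral>x. f x \<partial>mu)"
      using LIMSEQ_unique[OF lim[OF cf]] LIMSEQ_subseq_LIMSEQ[OF m[OF f] r] by (simp add: marg o_def)
    finally show "(\<integral>x. f x \<partial>distr \<alpha> (restrict_space borel X) fst) = (\<integral>x. f x \<partial>mu)" .
  qed simp
  define h where "h x w = U x w - p w" for x w
  have ch: "continuous_on (X \<times> W) (\<lambda>(x, w). h x w)"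
  proof -
    have "continuous_on (X \<times> W) (\<lambda>z. p (snd z))"
      by (rule continuous_on_compose2[OF p]) (auto intro: continuous_intros)
    then show ?thesis using U unfolding h_def case_prod_unfold by (intro continuous_intros)
  qed
  define H where "H x = (SUP w\<in>W. h x w)" for x
  define gap where "gap z = H (fst z) - h (fst z) (snd z)" for z
  have chx: "continuous_on W (h x)" if "x \<in> X" for x
  proof -
    have "continuous_on W (\<lambda>w. case (x, w) of (x, w) \<Rightarrow> h x w)"
      by (rule continuous_on_compose2[OF ch]) (use that in \<open>auto intro!: continuous_intros\<close>)
    then show ?thesis by simp
  qed
  have Hup: "h x w \<le> H x" if "x \<in> X" "w \<in> W" for x w
    unfolding H_def by (rule cSUP_upper[OF that(2) bdd_above_continuous_image[OF W(1) chx[OF that(1)]]])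
  have "continuous_on X H"
    unfolding H_def by (rule continuous_on_SUP_compact[OF X W ch])
  then have "continuous_on (X \<times> W) (\<lambda>z. H (fst z))"
    by (rule continuous_on_compose2) (auto intro: continuous_intros)
  then have cgap: "continuous_on (X \<times> W) gap"
    using ch unfolding gap_def case_prod_unfold by (intro continuous_intros)
  \<comment> \<open>Three errors of size \<open>\<eta>\<close> arise: replacing a maximiser by a
    nearby grid point, and replacing the limit price by \<open>P n\<close> once at that grid point
    and once at the chosen option.\<close>
  have int_le: "(\<integral>z. gap z \<partial>\<alpha>) \<le> 3 * measure mu X * \<eta>" if \<eta>: "\<eta> > 0" for \<eta>
  proof -
    have "uniformly_continuous_on (X \<times> W) (\<lambda>(x, w). h x w)"
      by (intro compact_uniformly_continuous ch compact_Times X W(1))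
    then obtain d where d: "d > 0"
      "\<And>z z'. z \<in> X \<times> W \<Longrightarrow> z' \<in> X \<times> W \<Longrightarrow> dist z' z < d \<Longrightarrow> dist (case z' of (a, k) \<Rightarrow> h a k) (case z of (a, k) \<Rightarrow> h a k) < \<eta>"
      unfolding uniformly_continuous_on_def using \<eta> by blast
    have close: "h x w \<le> h x k + \<eta>" if "x \<in> X" "w \<in> W" "k \<in> W" "dist w k < d" for x w k
      using d(2)[of "(x, k)" "(x, w)"] that by (simp add: dist_Pair_Pair dist_real_def)
    obtain N1 where N1: "\<And>n w. n \<ge> N1 \<Longrightarrow> w \<in> W \<Longrightarrow> \<bar>P n w - p w\<bar> < \<eta>"
      using unif[OF \<eta>] by blast
    obtain N2 where N2: "\<And>n w. n \<ge> N2 \<Longrightarrow> w \<in> W \<Longrightarrow> \<exists>k\<in>G n. dist w k < d"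
      using dense[OF d(1)] by blast
    have bound: "(\<Sum>z\<in>I n \<times> G n. a n z * gap z) \<le> sum (m n) (I n) * (real (card (G n)) * \<epsilon> n + 3 * \<eta>)"
      if n: "n \<ge> max N1 N2" for n
    proof -
      let ?l = "logit (G n) (\<epsilon> n) U (P n)"
      have each: "?l i k * gap (i, k) \<le> \<epsilon> n + 3 * \<eta> * ?l i k" if i: "i \<in> I n" and k: "k \<in> G n" for i k
      proof -
        \<comment> \<open>The smoothed maximum. It dominates every value on the grid, since the
          partition function dominates each of its terms.\<close>
        define L where "L = \<epsilon> n * ln (logit_denom (G n) (\<epsilon> n) U (P n) i)"
        have iX: "i \<in> X" and kW: "k \<in> W" using i k I(2) G(2) by auto
        have L: "U i k' - P n k' \<le> L" if "k' \<in> G n" for k'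
        proof -
          have "(U i k' - P n k') / \<epsilon> n \<le> ln (logit_denom (G n) (\<epsilon> n) U (P n) i)"
            by (subst ln_ge_iff) (rule logit_denom_pos[OF G(1,3)] exp_le_logit_denom[OF G(1) that])+
          then show ?thesis using \<epsilon>(1)[of n] by (simp add: L_def divide_le_eq mult.commute)
        qed
        have "H i \<le> L + 2 * \<eta>"
          unfolding H_def
        proof (rule cSUP_least[OF W(2)])
          fix w assume w: "w \<in> W"
          obtain k' where k': "k' \<in> G n" "dist w k' < d" using N2[OF _ w, of n] n by auto
          then have "k' \<in> W" using G(2) by blast
          then show "h i w \<le> L + 2 * \<eta>"
            using close[OF iX w _ k'(2)] N1[of n k'] n L[OF k'(1)] by (simp add: h_def abs_less_iff)
        qed
        then have "gap (i, k) \<le> (L - (U i k - P n k)) + 3 * \<eta>"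
          using N1[OF _ kW, of n] n by (simp add: gap_def h_def abs_less_iff)
        moreover have "0 \<le> ?l i k"
          by (rule logit_nonneg[OF G(1,3)])
        ultimately have "?l i k * gap (i, k) \<le> ?l i k * ((L - (U i k - P n k)) + 3 * \<eta>)"
          by (rule mult_left_mono)
        then show ?thesis
          using logit_mult_gap_le[OF G(1) k \<epsilon>(1) L_def] by (simp add: distrib_left mult.commute)
      qed
      have "(\<Sum>z\<in>I n \<times> G n. a n z * gap z) = (\<Sum>i\<in>I n. m n i * (\<Sum>k\<in>G n. ?l i k * gap (i, k)))"
        by (simp add: a_def sum.cartesian_product case_prod_unfold mult.assoc sum_distrib_left)
      also have "\<dots> \<le> (\<Sum>i\<in>I n. m n i * (\<Sum>k\<in>G n. \<epsilon> n + 3 * \<eta> * ?l i k))"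
        by (intro sum_mono mult_left_mono I(3) each)
      also have "\<dots> = (\<Sum>i\<in>I n. m n i * (real (card (G n)) * \<epsilon> n + 3 * \<eta>))"
        using G by (simp add: sum.distrib sum_logit flip: sum_distrib_left)
      finally show ?thesis by (simp add: sum_distrib_right)
    qed
    have "(\<lambda>n. sum (m (r n)) (I (r n)) * (real (card (G (r n))) * \<epsilon> (r n) + 3 * \<eta>)) \<longlonglongrightarrow> measure mu X * (0 + 3 * \<eta>)"
      using LIMSEQ_subseq_LIMSEQ[OF mass r] LIMSEQ_subseq_LIMSEQ[OF \<epsilon>(2) r]
      by (intro tendsto_intros) (auto simp: o_def)
    moreover have "\<exists>N. \<forall>n\<ge>N. (\<Sum>z\<in>I (r n) \<times> G (r n). a (r n) z * gap z) \<le> sum (m (r n)) (I (r n)) * (real (card (G (r n))) * \<epsilon> (r n) + 3 * \<eta>)"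
      using bound seq_suble[OF r] le_trans by blast
    ultimately have "(\<integral>z. gap z \<partial>\<alpha>) \<le> measure mu X * (0 + 3 * \<eta>)"
      by (rule LIMSEQ_le[OF lim[OF cgap]])
    then show ?thesis by simp
  qed
  have "(\<integral>z. gap z \<partial>\<alpha>) \<le> 0"
  proof (rule field_le_epsilon)
    fix e :: real assume e: "e > 0"
    \<comment> \<open>The summand 1 again keeps the divisor positive when \<open>mu\<close> is
      zero.\<close>
    define c where "c = 3 * measure mu X + 1"
    have c: "c > 0" by (simp add: c_def add_nonneg_pos)
    then have "e / c > 0" using e by simp
    from int_le[OF this] have "(\<integral>z. gap z \<partial>\<alpha>) \<le> (c - 1) * (e / c)" by (simp add: c_def)
    also have "\<dots> \<le> c * (e / c)" using \<open>e / c > 0\<close> by (intro mult_right_mono) auto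
    finally show "(\<integral>z. gap z \<partial>\<alpha>) \<le> 0 + e" using c by simp
  qed
  moreover have nn: "AE z in \<alpha>. 0 \<le> gap z"
    by (intro AE_I2) (use Hup in \<open>auto simp: gap_def sp\<alpha>\<close>)
  ultimately have "(\<integral>z. gap z \<partial>\<alpha>) = 0"
    using integral_nonneg_AE[OF nn] by linarith
  then have "AE z in \<alpha>. gap z = 0"
    using integral_nonneg_eq_0_iff_AE[OF integrable_continuous_on_compact[OF compact_Times[OF X W(1)] fin\<alpha> sets\<alpha> cgap] nn]
    by blast
  moreover have "AE z in \<alpha>. z \<in> X \<times> W" by (intro AE_I2) (simp add: sp\<alpha>)
  ultimately have argmax: "AE z in \<alpha>. snd z \<in> W \<and> (\<forall>w'\<in>W. U (fst z) w' - p w' \<le> U (fst z) (snd z) - p (snd z))"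
    by eventually_elim (use Hup in \<open>fastforce simp: gap_def h_def\<close>)
  show thesis
  proof (rule that[OF r fin\<alpha> sets\<alpha> argmax distr])
    fix f :: "'x \<times> 'w \<Rightarrow> real" assume "continuous_on (X \<times> W) f"
    note lim[OF this]
    moreover have "(\<Sum>z\<in>I n \<times> G n. a n z * f z) = (\<Sum>k\<in>G n. \<Sum>i\<in>I n. m n i * logit (G n) (\<epsilon> n) U (P n) i k * f (i, k))" for n
      by (subst sum.swap) (simp add: a_def sum.cartesian_product case_prod_unfold)
    ultimately show "(\<lambda>n. \<Sum>k\<in>G (r n). \<Sum>i\<in>I (r n). m (r n) i * logit (G (r n)) (\<epsilon> (r n)) U (P (r n)) i k * f (i, k))
         \<longlonglongrightarrow> (\<integral>xw. f xw \<partial>\<alpha>)" by simp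
  qed
qed

section \<open>Demand distributions\<close>

lemma znd_neq_zns [simp]: "znd \<noteq> zns" "zns \<noteq> znd"
  by (auto simp: znd_def zns_def)

lemma null_points_notin_zemb [simp]: "znd \<notin> zemb ` Z0" "zns \<notin> zemb ` Z0"
  by (auto simp: znd_def zns_def zemb_def)

lemma null_points_in_Zset [simp]: "znd \<in> Zset Z0" "zns \<in> Zset Z0"
  by (auto simp: Zset_def)

lemma zemb_subset_Zset: "zemb ` Z0 \<subseteq> Zset Z0"
  by (auto simp: Zset_def)

lemma Zset_minus_null_points: "Zset Z0 - {znd, zns} = zemb ` Z0"
  using null_points_notin_zemb[of Z0] by (auto simp: Zset_def)

lemma Zset_cases:
  assumes "w \<in> Zset Z0"
  obtains "w = znd" | "w = zns" | z where "z \<in> Z0" "w = zemb z"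
  using assms by (auto simp: Zset_def)

lemma uext_simps [simp]:
  "uext u x znd = 0" "uext u x zns = -1" "uext u x (zemb z) = u x z"
  by (auto simp: uext_def znd_def zns_def zemb_def)

lemma vext_simps [simp]:
  "vext v y zns = 0" "vext v y znd = 1" "vext v y (zemb z) = v y z"
  by (auto simp: vext_def znd_def zns_def zemb_def)

lemma compact_zemb_image: "compact Z0 \<Longrightarrow> compact (zemb ` Z0)"
  unfolding zemb_def by (intro compact_continuous_image continuous_intros)

lemma compact_Zset: "compact Z0 \<Longrightarrow> compact (Zset Z0)"
  unfolding Zset_def by (intro compact_Un compact_zemb_image) auto

text \<open>The two added points are isolated, so values there are unconstrained. In particular,
  extending by 0 from the genuine qualities preserves continuity.\<close>

lemma continuous_on_ZsetI:
  assumes "compact Z0" "continuous_on (zemb ` Z0) f"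
  shows "continuous_on (Zset Z0) f"
  unfolding Zset_def
proof (rule continuous_on_closed_Un)
  show "closed (zemb ` Z0)" by (rule compact_imp_closed[OF compact_zemb_image[OF assms(1)]])
qed (use assms in \<open>auto intro: continuous_on_finite\<close>)

lemma continuous_on_Times_ZsetI:
  fixes X :: "'x::t2_space set"
  assumes "compact X" "compact Z0" "continuous_on (X \<times> zemb ` Z0) f"
    "continuous_on X (\<lambda>x. f (x, znd))" "continuous_on X (\<lambda>x. f (x, zns))"
  shows "continuous_on (X \<times> Zset Z0) f"
proof -
  have pt: "continuous_on (X \<times> {w}) f" if "continuous_on X (\<lambda>x. f (x, w))" for w
  proof -
    have "continuous_on (X \<times> {w}) (\<lambda>z. f (fst z, w))"
      by (rule continuous_on_compose2[OF that]) (auto intro: continuous_intros)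
    then show ?thesis by (rule continuous_on_eq) auto
  qed
  have "continuous_on (X \<times> zemb ` Z0 \<union> (X \<times> {znd} \<union> X \<times> {zns})) f"
    using assms compact_imp_closed[OF compact_zemb_image]
    by (intro continuous_on_closed_Un pt closed_Times closed_Un) (auto simp: compact_imp_closed)
  moreover have "X \<times> Zset Z0 = X \<times> zemb ` Z0 \<union> (X \<times> {znd} \<union> X \<times> {zns})"
    by (auto simp: Zset_def)
  ultimately show ?thesis by simp
qed

lemma continuous_on_zemb_Times:
  assumes "continuous_on (X \<times> Z0) (\<lambda>(x, z). f x z)"
  shows "continuous_on (X \<times> zemb ` Z0) (\<lambda>(x, w). f x (fst w))"
proof -
  have "continuous_on (X \<times> zemb ` Z0) (\<lambda>q. case (fst q, fst (snd q)) of (x, z) \<Rightarrow> f x z)"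
    by (rule continuous_on_compose2[OF assms]) (auto intro!: continuous_intros simp: zemb_def)
  then show ?thesis by (simp add: case_prod_unfold)
qed

lemma continuous_on_uext:
  fixes X :: "'x::t2_space set"
  assumes "compact X" "compact Z0" "continuous_on (X \<times> Z0) (\<lambda>(x, z). u x z)"
  shows "continuous_on (X \<times> Zset Z0) (\<lambda>(x, w). uext u x w)"
  by (rule continuous_on_Times_ZsetI[OF assms(1,2)])
    (use continuous_on_zemb_Times[OF assms(3)] in \<open>auto elim!: continuous_on_eq simp: zemb_def uext_def znd_def zns_def\<close>)

lemma continuous_on_vext:
  fixes Y :: "'x::t2_space set"
  assumes "compact Y" "compact Z0" "continuous_on (Y \<times> Z0) (\<lambda>(y, z). v y z)"
  shows "continuous_on (Y \<times> Zset Z0) (\<lambda>(y, w). vext v y w)"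
  by (rule continuous_on_Times_ZsetI[OF assms(1,2)])
    (use continuous_on_zemb_Times[OF assms(3)] in \<open>auto elim!: continuous_on_eq simp: zemb_def vext_def znd_def zns_def\<close>)

text \<open>The supply side is the demand side for the utility \<open>-V\<close> and the price \<open>-p\<close>.\<close>

lemma Scorr_eq_Dcorr: "Scorr Z0 V p y = Dcorr Z0 (\<lambda>y w. - V y w) (\<lambda>w. - p w) y"
  unfolding Scorr_def Dcorr_def by (intro Collect_cong conj_cong ball_cong) auto

lemma supply_dist_eq_demand_dist:
  "supply_dist Y Z0 V nu p \<beta> = demand_dist Y Z0 (\<lambda>y w. - V y w) nu (\<lambda>w. - p w) \<beta>"
  by (simp add: supply_dist_def demand_dist_def Scorr_eq_Dcorr)

lemma afun_eq_bfun: "afun Y V w = - bfun Y (\<lambda>y w. - V y w) w"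
  by (simp add: afun_def bfun_def Inf_real_def image_image)

lemma pflat_eq_psharp: "pflat Z0 V p y = - psharp Z0 (\<lambda>y w. - V y w) (\<lambda>w. - p w) y"
  by (simp add: pflat_def psharp_def Inf_real_def image_image)

lemma pflatflat_eq_psharpsharp:
  "pflatflat Y Z0 V p w = - psharpsharp Y Z0 (\<lambda>y w. - V y w) (\<lambda>w. - p w) w"
  by (simp add: pflatflat_def psharpsharp_def pflat_eq_psharp Inf_real_def image_image)

text \<open>Values of \<open>U\<close> at the added points are left open, because consumers and
  suppliers have different outside options; both sides are instances.\<close>

locale demand_side =
  fixes X :: "'x::euclidean_space set" and Z0 :: "'z::euclidean_space set"
    and U :: "'x \<Rightarrow> 'z \<times> real \<Rightarrow> real" and mu :: "'x measure"
  assumes X: "compact X" "X \<noteq> {}" and Z0: "compact Z0"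
    and mu: "finite_measure mu" "sets mu = sets (restrict_space borel X)"
    and U: "continuous_on (X \<times> Zset Z0) (\<lambda>(x, w). U x w)"
begin

section \<open>Conjugate prices on one side of the market\<close>

lemma compact_domain: "compact (X \<times> Zset Z0)"
  using X(1) compact_Zset[OF Z0] by (rule compact_Times)

lemma Zset_nonempty: "Zset Z0 \<noteq> {}"
  using null_points_in_Zset by blast

lemma continuous_on_snd_price:
  "continuous_on (Zset Z0) p \<Longrightarrow> continuous_on (X \<times> Zset Z0) (\<lambda>z. p (snd z))"
  by (erule continuous_on_compose2) (auto intro: continuous_intros)

lemma continuous_on_net_utility:
  assumes "continuous_on (Zset Z0) p"
  shows "continuous_on (X \<times> Zset Z0) (\<lambda>(x, w). U x w - p w)"
  using U continuous_on_snd_price[OF assms] unfolding case_prod_unfold by (intro continuous_intros)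

lemma continuous_on_section:
  assumes "continuous_on (X \<times> Zset Z0) (\<lambda>(x, w). h x w)"
  shows "x \<in> X \<Longrightarrow> continuous_on (Zset Z0) (\<lambda>w. h x w)"
    and "w \<in> Zset Z0 \<Longrightarrow> continuous_on X (\<lambda>x. h x w)"
proof -
  assume "x \<in> X"
  then have "continuous_on (Zset Z0) (\<lambda>w. case (x, w) of (x, w) \<Rightarrow> h x w)"
    by (intro continuous_on_compose2[OF assms]) (auto intro!: continuous_intros)
  then show "continuous_on (Zset Z0) (\<lambda>w. h x w)" by simp
next
  assume "w \<in> Zset Z0"
  then have "continuous_on X (\<lambda>x. case (x, w) of (x, w) \<Rightarrow> h x w)"
    by (intro continuous_on_compose2[OF assms]) (auto intro!: continuous_intros)
  then show "continuous_on X (\<lambda>x. h x w)" by simp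
qed

lemma psharp_upper:
  assumes "continuous_on (Zset Z0) p" "x \<in> X" "w \<in> Zset Z0"
  shows "U x w - p w \<le> psharp Z0 U p x"
  unfolding psharp_def
  by (rule cSUP_upper[OF assms(3) bdd_above_continuous_image[OF compact_Zset[OF Z0]]])
    (rule continuous_on_section(1)[OF continuous_on_net_utility[OF assms(1)] assms(2)])

lemma psharp_eq_iff_Dcorr:
  assumes "continuous_on (Zset Z0) p" "x \<in> X" "w \<in> Zset Z0"
  shows "w \<in> Dcorr Z0 U p x \<longleftrightarrow> psharp Z0 U p x = U x w - p w"
proof
  assume "w \<in> Dcorr Z0 U p x"
  then have "psharp Z0 U p x \<le> U x w - p w"
    unfolding psharp_def by (intro cSUP_least Zset_nonempty) (auto simp: Dcorr_def)
  with psharp_upper[OF assms] show "psharp Z0 U p x = U x w - p w" by simp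
next
  assume "psharp Z0 U p x = U x w - p w"
  then show "w \<in> Dcorr Z0 U p x"
    using psharp_upper[OF assms(1,2)] assms(3) by (auto simp: Dcorr_def)
qed

lemma continuous_on_psharp:
  assumes "continuous_on (Zset Z0) p" shows "continuous_on X (psharp Z0 U p)"
  unfolding psharp_def
  by (rule continuous_on_SUP_compact[OF X(1) compact_Zset[OF Z0] Zset_nonempty continuous_on_net_utility[OF assms]])

lemma continuous_on_swap_SUP:
  fixes h :: "'x \<Rightarrow> 'z \<times> real \<Rightarrow> real"
  assumes "continuous_on (X \<times> Zset Z0) (\<lambda>(x, w). h x w)"
  shows "continuous_on (Zset Z0) (\<lambda>w. SUP x\<in>X. h x w)"
proof (rule continuous_on_SUP_compact[OF compact_Zset[OF Z0] X])
  have "continuous_on (Zset Z0 \<times> X) (\<lambda>q. case (snd q, fst q) of (x, w) \<Rightarrow> h x w)"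
    by (rule continuous_on_compose2[OF assms]) (auto intro!: continuous_intros)
  then show "continuous_on (Zset Z0 \<times> X) (\<lambda>(w, x). h x w)" by (simp add: case_prod_unfold)
qed

lemma continuous_on_dual_utility:
  assumes "continuous_on (Zset Z0) p"
  shows "continuous_on (X \<times> Zset Z0) (\<lambda>(x, w). U x w - psharp Z0 U p x)"
proof -
  have "continuous_on (X \<times> Zset Z0) (\<lambda>z. psharp Z0 U p (fst z))"
    by (rule continuous_on_compose2[OF continuous_on_psharp[OF assms]]) (auto intro: continuous_intros)
  then show ?thesis using U unfolding case_prod_unfold by (intro continuous_intros)
qed

lemma continuous_on_psharpsharp:
  assumes "continuous_on (Zset Z0) p" shows "continuous_on (Zset Z0) (psharpsharp X Z0 U p)"
  unfolding psharpsharp_def by (rule continuous_on_swap_SUP[OF continuous_on_dual_utility[OF assms]])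

lemma psharpsharp_upper:
  assumes "continuous_on (Zset Z0) p" "x \<in> X" "w \<in> Zset Z0"
  shows "U x w - psharp Z0 U p x \<le> psharpsharp X Z0 U p w"
  unfolding psharpsharp_def
  by (rule cSUP_upper[OF assms(2) bdd_above_continuous_image[OF X(1)]])
    (rule continuous_on_section(2)[OF continuous_on_dual_utility[OF assms(1)] assms(3)])

lemma psharpsharp_le:
  assumes "continuous_on (Zset Z0) p" "w \<in> Zset Z0"
  shows "psharpsharp X Z0 U p w \<le> p w"
  unfolding psharpsharp_def
proof (rule cSUP_least[OF X(2)])
  fix x assume "x \<in> X"
  from psharp_upper[OF assms(1) this assms(2)] show "U x w - psharp Z0 U p x \<le> p w" by simp
qed

lemma continuous_on_bfun: "continuous_on (Zset Z0) (bfun X U)"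
  unfolding bfun_def by (rule continuous_on_swap_SUP[OF U])

lemma bfun_upper: "x \<in> X \<Longrightarrow> w \<in> Zset Z0 \<Longrightarrow> U x w \<le> bfun X U w"
  unfolding bfun_def
  by (erule cSUP_upper[OF _ bdd_above_continuous_image[OF X(1)]]) (rule continuous_on_section(2)[OF U])

context
  fixes p \<alpha> assumes p: "continuous_on (Zset Z0) p" and \<alpha>: "demand_dist X Z0 U mu p \<alpha>"
begin

section \<open>A fixed demand distribution\<close>

lemma sets_demand: "sets \<alpha> = sets (restrict_space borel (X \<times> Zset Z0))"
  using \<alpha> by (simp add: demand_dist_def)

lemma space_demand: "space \<alpha> = X \<times> Zset Z0"
  using sets_eq_imp_space_eq[OF sets_demand] by (simp add: space_restrict_space)

lemma measurable_demand:
  "fst \<in> measurable \<alpha> (restrict_space borel X)" "snd \<in> measurable \<alpha> (restrict_space borel (Zset Z0))"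
  using measurable_fst_restrict_Times measurable_snd_restrict_Times measurable_cong_sets[OF sets_demand refl] by blast+

lemma finite_measure_demand: "finite_measure \<alpha>"
proof (rule finite_measureI)
  have "emeasure \<alpha> (space \<alpha>) = emeasure (distr \<alpha> (restrict_space borel X) fst) X"
    by (subst emeasure_distr[OF measurable_demand(1)])
      (auto simp: space_demand sets_restrict_space intro!: arg_cong[of _ _ "emeasure \<alpha>"])
  also have "\<dots> = emeasure mu X" using \<alpha> by (simp add: demand_dist_def)
  finally show "emeasure \<alpha> (space \<alpha>) \<noteq> \<infinity>"
    using finite_measure.emeasure_finite[OF mu(1)] by simp
qed

lemma finite_measure_zmarg: "finite_measure (zmarg Z0 \<alpha>)"
  unfolding zmarg_def using finite_measure_demand measurable_demand(2) by (rule finite_measure.finite_measure_distr)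

lemma integral_fst_demand:
  fixes f :: "'x \<Rightarrow> real"
  assumes "continuous_on X f" shows "(\<integral>z. f (fst z) \<partial>\<alpha>) = (\<integral>x. f x \<partial>mu)"
  using integral_distr[OF measurable_demand(1) borel_measurable_continuous_on_restrict[OF assms]] \<alpha>
  by (simp add: demand_dist_def)

lemma integral_zmarg:
  fixes f :: "'z \<times> real \<Rightarrow> real"
  assumes "continuous_on (Zset Z0) f" shows "(\<integral>w. f w \<partial>zmarg Z0 \<alpha>) = (\<integral>z. f (snd z) \<partial>\<alpha>)"
  unfolding zmarg_def
  by (rule integral_distr[OF measurable_demand(2) borel_measurable_continuous_on_restrict[OF assms]])

lemma integrable_demand:
  fixes f :: "'x \<times> 'z \<times> real \<Rightarrow> real"
  assumes "continuous_on (X \<times> Zset Z0) f" shows "integrable \<alpha> f"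
  by (rule integrable_continuous_on_compact[OF compact_domain finite_measure_demand sets_demand assms])

text \<open>Tests \<open>\<alpha>\<close>, chosen at p, against another price q. The integrand is
  p-sharp, taken at q, minus the net utility of the chosen quality; it is nonnegative and zero
  exactly where that quality is optimal at q. Hence equality of the integrals means that
  \<open>\<alpha>\<close> is a demand distribution at q as well.\<close>

lemma duality_gap:
  assumes q: "continuous_on (Zset Z0) q"
  shows "(\<integral>z. U (fst z) (snd z) \<partial>\<alpha>) - (\<integral>w. q w \<partial>zmarg Z0 \<alpha>) \<le> (\<integral>x. psharp Z0 U q x \<partial>mu)"
    and "(\<integral>z. U (fst z) (snd z) \<partial>\<alpha>) - (\<integral>w. q w \<partial>zmarg Z0 \<alpha>) = (\<integral>x. psharp Z0 U q x \<partial>mu)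
      \<longleftrightarrow> demand_dist X Z0 U mu q \<alpha>"
proof -
  let ?g = "\<lambda>z. psharp Z0 U q (fst z) - (U (fst z) (snd z) - q (snd z))"
  have cp: "continuous_on (X \<times> Zset Z0) (\<lambda>z. psharp Z0 U q (fst z))"
    by (rule continuous_on_compose2[OF continuous_on_psharp[OF q]]) (auto intro: continuous_intros)
  have cU: "continuous_on (X \<times> Zset Z0) (\<lambda>z. U (fst z) (snd z))"
    using U by (simp add: case_prod_unfold)
  note cq = continuous_on_snd_price[OF q]
  have cg: "continuous_on (X \<times> Zset Z0) ?g"
    using cp cU cq by (intro continuous_intros)
  have ig: "(\<integral>z. ?g z \<partial>\<alpha>) = (\<integral>x. psharp Z0 U q x \<partial>mu)
      - ((\<integral>z. U (fst z) (snd z) \<partial>\<alpha>) - (\<integral>w. q w \<partial>zmarg Z0 \<alpha>))"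
    using integrable_demand[OF cp] integrable_demand[OF cU] integrable_demand[OF cq]
    by (simp add: integral_fst_demand[OF continuous_on_psharp[OF q]] integral_zmarg[OF q])
  have nn: "AE z in \<alpha>. 0 \<le> ?g z"
    by (intro AE_I2) (use psharp_upper[OF q] in \<open>auto simp: space_demand\<close>)
  show "(\<integral>z. U (fst z) (snd z) \<partial>\<alpha>) - (\<integral>w. q w \<partial>zmarg Z0 \<alpha>) \<le> (\<integral>x. psharp Z0 U q x \<partial>mu)"
    using integral_nonneg_AE[OF nn] ig by linarith
  have "(\<integral>z. ?g z \<partial>\<alpha>) = 0 \<longleftrightarrow> (AE z in \<alpha>. ?g z = 0)"
    by (rule integral_nonneg_eq_0_iff_AE[OF integrable_demand[OF cg] nn])
  also have "\<dots> \<longleftrightarrow> (AE z in \<alpha>. snd z \<in> Dcorr Z0 U q (fst z))"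
    by (rule AE_cong) (use psharp_eq_iff_Dcorr[OF q] in \<open>auto simp: space_demand\<close>)
  also have "\<dots> \<longleftrightarrow> demand_dist X Z0 U mu q \<alpha>"
    using \<alpha> by (simp add: demand_dist_def)
  finally show "(\<integral>z. U (fst z) (snd z) \<partial>\<alpha>) - (\<integral>w. q w \<partial>zmarg Z0 \<alpha>) = (\<integral>x. psharp Z0 U q x \<partial>mu)
      \<longleftrightarrow> demand_dist X Z0 U mu q \<alpha>"
    using ig by linarith
qed

lemma AE_zmarg_continuous_le:
  assumes "continuous_on (Zset Z0) f" "continuous_on (Zset Z0) (g :: _ \<Rightarrow> real)"
    and "AE z in \<alpha>. f (snd z) \<le> g (snd z)"
  shows "AE w in zmarg Z0 \<alpha>. f w \<le> g w"
proof -
  have [measurable]: "f \<in> borel_measurable (restrict_space borel (Zset Z0))"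
    "g \<in> borel_measurable (restrict_space borel (Zset Z0))"
    by (intro borel_measurable_continuous_on_restrict assms)+
  show ?thesis
    unfolding zmarg_def by (subst AE_distr_iff[OF measurable_demand(2)]) (use assms(3) in auto)
qed

text \<open>If x chooses w, then p w = U x w - psharp x, which is one of the terms in the supremum
  defining the double conjugate at w.\<close>

lemma AE_price_le_psharpsharp: "AE w in zmarg Z0 \<alpha>. p w \<le> psharpsharp X Z0 U p w"
proof (rule AE_zmarg_continuous_le[OF p continuous_on_psharpsharp[OF p]])
  have "AE z in \<alpha>. snd z \<in> Dcorr Z0 U p (fst z)" using \<alpha> by (simp add: demand_dist_def)
  then show "AE z in \<alpha>. p (snd z) \<le> psharpsharp X Z0 U p (snd z)"
  proof (rule AE_mp, intro AE_I2 impI)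
    fix z assume z: "z \<in> space \<alpha>" and D: "snd z \<in> Dcorr Z0 U p (fst z)"
    then have "fst z \<in> X" "snd z \<in> Zset Z0" by (auto simp: space_demand)
    with D show "p (snd z) \<le> psharpsharp X Z0 U p (snd z)"
      using psharpsharp_upper[OF p, of "fst z" "snd z"] psharp_eq_iff_Dcorr[OF p, of "fst z" "snd z"] by auto
  qed
qed

lemma AE_psharpsharp_eq_price: "AE w in zmarg Z0 \<alpha>. psharpsharp X Z0 U p w = p w"
proof -
  have "AE w in zmarg Z0 \<alpha>. w \<in> Zset Z0"
    by (intro AE_I2) (simp add: zmarg_def space_restrict_space)
  with AE_price_le_psharpsharp show ?thesis
    by eventually_elim (use psharpsharp_le[OF p] in fastforce)
qed

text \<open>A chosen quality is at least as good as the outside option \<open>w0\<close>, which is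
  worth 0, so its price is at most U x w. On the supply side this reads a <= p.\<close>

lemma AE_price_le_bfun:
  assumes "p w0 = 0" "w0 \<in> Zset Z0" "\<And>x. U x w0 = 0"
  shows "AE w in zmarg Z0 \<alpha>. p w \<le> bfun X U w"
proof (rule AE_zmarg_continuous_le[OF p continuous_on_bfun])
  have "AE z in \<alpha>. snd z \<in> Dcorr Z0 U p (fst z)" using \<alpha> by (simp add: demand_dist_def)
  then show "AE z in \<alpha>. p (snd z) \<le> bfun X U (snd z)"
  proof (rule AE_mp, intro AE_I2 impI)
    fix z assume z: "z \<in> space \<alpha>" and D: "snd z \<in> Dcorr Z0 U p (fst z)"
    then have "U (fst z) w0 - p w0 \<le> U (fst z) (snd z) - p (snd z)" using assms by (auto simp: Dcorr_def)
    moreover have "U (fst z) (snd z) \<le> bfun X U (snd z)" using z bfun_upper by (auto simp: space_demand)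
    ultimately show "p (snd z) \<le> bfun X U (snd z)" using assms by simp
  qed
qed

text \<open>At the new price the chosen qualities still yield the old optimal value, by
  \<open>eq\<close>, and no quality yields more, by \<open>le\<close>; so the old choices remain
  optimal.\<close>

lemma demand_dist_change_price:
  assumes eq: "AE w in zmarg Z0 \<alpha>. q w = p w"
    and le: "\<And>x w. x \<in> X \<Longrightarrow> w \<in> Zset Z0 \<Longrightarrow> U x w - q w \<le> psharp Z0 U p x"
  shows "demand_dist X Z0 U mu q \<alpha>"
proof -
  have "AE z in \<alpha>. q (snd z) = p (snd z)"
    using eq AE_distrD[OF measurable_demand(2)] unfolding zmarg_def by blast
  moreover have "AE z in \<alpha>. snd z \<in> Dcorr Z0 U p (fst z)" using \<alpha> by (simp add: demand_dist_def)
  moreover have "AE z in \<alpha>. z \<in> X \<times> Zset Z0" by (intro AE_I2) (simp add: space_demand)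
  ultimately have "AE z in \<alpha>. snd z \<in> Dcorr Z0 U q (fst z)"
  proof eventually_elim
    case (elim z)
    then have x: "fst z \<in> X" "snd z \<in> Zset Z0" by auto
    have "psharp Z0 U p (fst z) = U (fst z) (snd z) - q (snd z)"
      using psharp_eq_iff_Dcorr[OF p x] elim by simp
    then show ?case using le[OF x(1)] x(2) by (auto simp: Dcorr_def)
  qed
  then show ?thesis using \<alpha> by (simp add: demand_dist_def)
qed

end

end

section \<open>Equilibria and duality\<close>

definition market_clearing ::
    "'z::euclidean_space set \<Rightarrow> ('x \<times> 'z \<times> real) measure \<Rightarrow> ('y \<times> 'z \<times> real) measure \<Rightarrow> bool" where
  "market_clearing Z0 \<alpha> \<beta> \<longleftrightarrow> (\<forall>A \<in> sets (restrict_space borel (Zset Z0)). A \<subseteq> zemb ` Z0 \<longrightarrow>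
     emeasure (zmarg Z0 \<alpha>) A = emeasure (zmarg Z0 \<beta>) A)"

lemma sets_zmarg: "sets (zmarg Z0 \<alpha>) = sets (restrict_space borel (Zset Z0))"
  by (simp add: zmarg_def)

lemma space_zmarg: "space (zmarg Z0 \<alpha>) = Zset Z0"
  by (simp add: zmarg_def space_restrict_space)

context
  fixes Z0 :: "'z::euclidean_space set" assumes Z0: "compact Z0"
begin

lemma zemb_image_in_sets_zmarg: "zemb ` Z0 \<in> sets (zmarg Z0 \<alpha>)"
proof -
  have "zemb ` Z0 \<in> sets borel" "Zset Z0 \<in> sets borel"
    using compact_imp_closed[OF compact_zemb_image[OF Z0]] compact_imp_closed[OF compact_Zset[OF Z0]]
    by (auto intro: borel_closed)
  then show ?thesis
    using zemb_subset_Zset[of Z0] unfolding sets_zmarg by (simp add: sets_restrict_space_iff)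
qed

lemma zemb_in_sets_zmarg: "zemb ` Z0 \<inter> space (zmarg Z0 \<alpha>) \<in> sets (zmarg Z0 \<alpha>)"
  using zemb_image_in_sets_zmarg by (rule sets.Int) simp

lemma sets_restrict_zmarg: "sets (restrict_space (zmarg Z0 \<alpha>) (zemb ` Z0)) = sets (restrict_space borel (zemb ` Z0))"
proof -
  have "sets (restrict_space (zmarg Z0 \<alpha>) (zemb ` Z0)) = sets (restrict_space (restrict_space borel (Zset Z0)) (zemb ` Z0))"
    by (rule sets_restrict_space_cong[OF sets_zmarg])
  also have "\<dots> = sets (restrict_space borel (Zset Z0 \<inter> zemb ` Z0))"
    by (rule sets_restrict_restrict_space)
  also have "Zset Z0 \<inter> zemb ` Z0 = zemb ` Z0" using zemb_subset_Zset by blast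
  finally show ?thesis .
qed

text \<open>As an equality of measures, clearing lets integrals and almost-everywhere statements on
  genuine qualities pass between the two sides by substitution.\<close>

lemma market_clearing_iff:
  "market_clearing Z0 \<alpha> \<beta> \<longleftrightarrow>
    restrict_space (zmarg Z0 \<alpha>) (zemb ` Z0) = restrict_space (zmarg Z0 \<beta>) (zemb ` Z0)"
proof
  assume clear: "market_clearing Z0 \<alpha> \<beta>"
  show "restrict_space (zmarg Z0 \<alpha>) (zemb ` Z0) = restrict_space (zmarg Z0 \<beta>) (zemb ` Z0)"
  proof (rule measure_eqI)
    fix A assume "A \<in> sets (restrict_space (zmarg Z0 \<alpha>) (zemb ` Z0))"
    then have A: "A \<subseteq> zemb ` Z0" "A \<in> sets (zmarg Z0 \<alpha>)"
      by (simp_all add: sets_restrict_space_iff[OF zemb_in_sets_zmarg])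
    then show "emeasure (restrict_space (zmarg Z0 \<alpha>) (zemb ` Z0)) A = emeasure (restrict_space (zmarg Z0 \<beta>) (zemb ` Z0)) A"
      using clear by (simp add: emeasure_restrict_space[OF zemb_in_sets_zmarg] market_clearing_def sets_zmarg)
  qed (simp add: sets_restrict_zmarg)
next
  assume eq: "restrict_space (zmarg Z0 \<alpha>) (zemb ` Z0) = restrict_space (zmarg Z0 \<beta>) (zemb ` Z0)"
  show "market_clearing Z0 \<alpha> \<beta>"
    unfolding market_clearing_def
  proof (intro ballI impI)
    fix A assume "A \<subseteq> zemb ` Z0"
    then show "emeasure (zmarg Z0 \<alpha>) A = emeasure (zmarg Z0 \<beta>) A"
      using arg_cong[OF eq, of "\<lambda>M. emeasure M A"] by (simp add: emeasure_restrict_space[OF zemb_in_sets_zmarg])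
  qed
qed

lemma AE_market_clearing:
  assumes "market_clearing Z0 \<alpha> \<beta>"
  shows "(AE w in zmarg Z0 \<alpha>. w \<in> zemb ` Z0 \<longrightarrow> P w) \<longleftrightarrow> (AE w in zmarg Z0 \<beta>. w \<in> zemb ` Z0 \<longrightarrow> P w)"
  using arg_cong[OF assms[unfolded market_clearing_iff], of "\<lambda>M. AE w in M. P w"]
  by (simp add: AE_restrict_space_iff[OF zemb_in_sets_zmarg])

lemma integral_zmarg_eq_restrict:
  fixes f :: "'z \<times> real \<Rightarrow> real"
  assumes "f znd = 0" "f zns = 0"
  shows "(\<integral>w. f w \<partial>zmarg Z0 \<alpha>) = (\<integral>w. f w \<partial>restrict_space (zmarg Z0 \<alpha>) (zemb ` Z0))"
  unfolding integral_restrict_space[OF zemb_in_sets_zmarg]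
  by (rule Bochner_Integration.integral_cong) (use assms in \<open>auto simp: space_zmarg Zset_def\<close>)

text \<open>The marginals may carry different masses at the two added points, hence the vanishing
  conditions on f. Price systems satisfy them by definition.\<close>

lemma integral_market_clearing:
  fixes f :: "'z \<times> real \<Rightarrow> real"
  assumes "market_clearing Z0 \<alpha> \<beta>" "f znd = 0" "f zns = 0"
  shows "(\<integral>w. f w \<partial>zmarg Z0 \<alpha>) = (\<integral>w. f w \<partial>zmarg Z0 \<beta>)"
  using assms unfolding market_clearing_iff
  by (simp only: integral_zmarg_eq_restrict[OF assms(2,3), of \<alpha>] integral_zmarg_eq_restrict[OF assms(2,3), of \<beta>])

text \<open>A test function on the genuine qualities extends continuously by 0, so equality of
  integrals against such extensions determines the restricted marginals.\<close>

lemma market_clearingI: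
  assumes fin: "finite_measure (zmarg Z0 \<alpha>)" "finite_measure (zmarg Z0 \<beta>)"
    and eq: "\<And>f::'z \<times> real \<Rightarrow> real. continuous_on (Zset Z0) f \<Longrightarrow> f znd = 0 \<Longrightarrow> f zns = 0 \<Longrightarrow>
      (\<integral>w. f w \<partial>zmarg Z0 \<alpha>) = (\<integral>w. f w \<partial>zmarg Z0 \<beta>)"
  shows "market_clearing Z0 \<alpha> \<beta>"
  unfolding market_clearing_iff
proof (rule finite_measure_eqI_continuous[OF compact_zemb_image[OF Z0]])
  fix f :: "'z \<times> real \<Rightarrow> real" assume f: "continuous_on (zemb ` Z0) f"
  define f' where "f' w = (if w \<in> zemb ` Z0 then f w else 0)" for w
  have c: "continuous_on (Zset Z0) f'"
    using f by (intro continuous_on_ZsetI[OF Z0]) (auto elim: continuous_on_eq simp: f'_def)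
  have z: "f' znd = 0" "f' zns = 0" by (simp_all add: f'_def)
  have "(\<integral>w. f w \<partial>restrict_space M (zemb ` Z0)) = (\<integral>w. f' w \<partial>restrict_space M (zemb ` Z0))" for M
    by (rule Bochner_Integration.integral_cong) (auto simp: space_restrict_space f'_def)
  then show "(\<integral>w. f w \<partial>restrict_space (zmarg Z0 \<alpha>) (zemb ` Z0)) = (\<integral>w. f w \<partial>restrict_space (zmarg Z0 \<beta>) (zemb ` Z0))"
    using eq[OF c z] integral_zmarg_eq_restrict[OF z, of \<alpha>] integral_zmarg_eq_restrict[OF z, of \<beta>] by simp
qed (rule finite_measure_restrict_space fin zemb_image_in_sets_zmarg sets_restrict_zmarg)+

end

text \<open>For a common distribution the optimality inequalities at p and q can be averaged,
  because net utility is affine in the price.\<close>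

lemma demand_dist_convex:
  assumes "demand_dist A Z0 B M p \<gamma>" "demand_dist A Z0 B M q \<gamma>" "0 \<le> t" "t \<le> 1"
  shows "demand_dist A Z0 B M (\<lambda>w. (1 - t) * p w + t * q w) \<gamma>"
proof -
  have D: "w \<in> Dcorr Z0 B (\<lambda>w. (1 - t) * p w + t * q w) x" if "w \<in> Dcorr Z0 B p x" "w \<in> Dcorr Z0 B q x" for w x
  proof -
    have "B x w' - ((1 - t) * p w' + t * q w') \<le> B x w - ((1 - t) * p w + t * q w)" if "w' \<in> Zset Z0" for w'
    proof -
      have "(1 - t) * (B x w' - p w') + t * (B x w' - q w') \<le> (1 - t) * (B x w - p w) + t * (B x w - q w)"
        using \<open>w \<in> Dcorr Z0 B p x\<close> \<open>w \<in> Dcorr Z0 B q x\<close> that assms(3,4)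
        by (intro add_mono mult_left_mono) (auto simp: Dcorr_def)
      then show ?thesis by (simp add: algebra_simps)
    qed
    then show ?thesis using that(1) by (simp add: Dcorr_def)
  qed
  have "AE z in \<gamma>. snd z \<in> Dcorr Z0 B p (fst z)" "AE z in \<gamma>. snd z \<in> Dcorr Z0 B q (fst z)"
    using assms by (simp_all add: demand_dist_def)
  then have "AE z in \<gamma>. snd z \<in> Dcorr Z0 B (\<lambda>w. (1 - t) * p w + t * q w) (fst z)"
    by eventually_elim (rule D)
  then show ?thesis using assms(1) by (simp add: demand_dist_def)
qed

locale hedonic_market =
  D: demand_side X Z0 U mu + S: demand_side Y Z0 "\<lambda>y w. - V y w" nu
  for X :: "'x::euclidean_space set" and Y :: "'y::euclidean_space set" and Z0 :: "'z::euclidean_space set"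
    and U V mu nu +
  assumes U_null: "\<And>x. U x znd = 0" "\<And>x. U x zns = -1"
    and V_null: "\<And>y. V y zns = 0" "\<And>y. V y znd = 1"
begin

section \<open>The two sides together\<close>

lemma equilibrium_iff:
  "equilibrium X Y Z0 U V mu nu p \<alpha> \<beta> \<longleftrightarrow> admissible X Y Z0 U V p \<and> demand_dist X Z0 U mu p \<alpha> \<and>
    demand_dist Y Z0 (\<lambda>y w. - V y w) nu (\<lambda>w. - p w) \<beta> \<and> market_clearing Z0 \<alpha> \<beta>"
  by (simp add: equilibrium_def supply_dist_eq_demand_dist market_clearing_def)

lemma admissibleD:
  assumes "admissible X Y Z0 U V p"
  shows "continuous_on (Zset Z0) p" "continuous_on (Zset Z0) (\<lambda>w. - p w)" "p znd = 0" "p zns = 0"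
  using assms by (auto simp: admissible_def price_system_def intro: continuous_intros)

text \<open>At the two points, (a, b) is (1, 0) and (0, -1), so a > b. Admissibility therefore does
  not conflict with the prescribed price 0 there.\<close>

lemma null_notin_Z1set: "znd \<notin> Z1set X Y Z0 U V" "zns \<notin> Z1set X Y Z0 U V"
  using D.X(2) S.X(2) by (simp_all add: Z1set_def afun_def bfun_def U_null V_null)

text \<open>Each side gives the equality with its own conjugate, almost everywhere for its own
  marginal; clearing transports both equalities to the other marginal on the genuine
  qualities.\<close>

lemma equilibrium_AE_conjugates:
  assumes "equilibrium X Y Z0 U V mu nu p \<alpha> \<beta>"
  shows "AE w in zmarg Z0 \<alpha>. w \<in> zemb ` Z0 \<longrightarrow> psharpsharp X Z0 U p w = p w \<and> p w = pflatflat Y Z0 V p w"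
    and "AE w in zmarg Z0 \<beta>. w \<in> zemb ` Z0 \<longrightarrow> psharpsharp X Z0 U p w = p w \<and> p w = pflatflat Y Z0 V p w"
proof -
  note e = assms[unfolded equilibrium_iff]
  then have p: "continuous_on (Zset Z0) p" "continuous_on (Zset Z0) (\<lambda>w. - p w)"
    and mc: "market_clearing Z0 \<alpha> \<beta>" and d: "demand_dist X Z0 U mu p \<alpha>"
    and d': "demand_dist Y Z0 (\<lambda>y w. - V y w) nu (\<lambda>w. - p w) \<beta>"
    using admissibleD by blast+
  have "AE w in zmarg Z0 \<alpha>. psharpsharp X Z0 U p w = p w"
    by (rule D.AE_psharpsharp_eq_price[OF p(1) d])
  moreover have "AE w in zmarg Z0 \<beta>. p w = pflatflat Y Z0 V p w"
  proof -
    have "AE w in zmarg Z0 \<beta>. psharpsharp Y Z0 (\<lambda>y w. - V y w) (\<lambda>w. - p w) w = - p w"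
      by (rule S.AE_psharpsharp_eq_price[OF p(2) d'])
    then show ?thesis by eventually_elim (simp add: pflatflat_eq_psharpsharp)
  qed
  then have "AE w in zmarg Z0 \<beta>. w \<in> zemb ` Z0 \<longrightarrow> p w = pflatflat Y Z0 V p w"
    by eventually_elim simp
  then have "AE w in zmarg Z0 \<alpha>. w \<in> zemb ` Z0 \<longrightarrow> p w = pflatflat Y Z0 V p w"
    unfolding AE_market_clearing[OF D.Z0 mc] .
  ultimately show *: "AE w in zmarg Z0 \<alpha>. w \<in> zemb ` Z0 \<longrightarrow> psharpsharp X Z0 U p w = p w \<and> p w = pflatflat Y Z0 V p w"
    by eventually_elim simp
  then show "AE w in zmarg Z0 \<beta>. w \<in> zemb ` Z0 \<longrightarrow> psharpsharp X Z0 U p w = p w \<and> p w = pflatflat Y Z0 V p w"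
    unfolding AE_market_clearing[OF D.Z0 mc] .
qed

lemma AE_zmarg_Zset: "AE w in zmarg Z0 \<gamma>. w \<in> Zset Z0"
  by (intro AE_I2) (simp add: space_zmarg)

text \<open>At traded qualities both conjugates equal p, which forces q = p. Elsewhere, q being at
  least the double sharp conjugate says that no consumer gains by switching, and the upper bound
  says the same for suppliers.\<close>

lemma equilibrium_between_conjugates:
  assumes eqm: "equilibrium X Y Z0 U V mu nu p \<alpha> \<beta>" and q: "admissible X Y Z0 U V q"
    and between: "\<And>w. w \<in> Zset Z0 \<Longrightarrow> psharpsharp X Z0 U p w \<le> q w \<and> q w \<le> pflatflat Y Z0 V p w"
  shows "equilibrium X Y Z0 U V mu nu q \<alpha> \<beta>"
proof -
  note e = eqm[unfolded equilibrium_iff]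
  then have p: "continuous_on (Zset Z0) p" "continuous_on (Zset Z0) (\<lambda>w. - p w)" "p znd = 0" "p zns = 0"
    and mc: "market_clearing Z0 \<alpha> \<beta>" and d: "demand_dist X Z0 U mu p \<alpha>"
    and d': "demand_dist Y Z0 (\<lambda>y w. - V y w) nu (\<lambda>w. - p w) \<beta>"
    using admissibleD by blast+
  note q0 = admissibleD(3,4)[OF q]
  have eq: "q w = p w"
    if "w \<in> Zset Z0" "w \<in> zemb ` Z0 \<longrightarrow> psharpsharp X Z0 U p w = p w \<and> p w = pflatflat Y Z0 V p w" for w
    using that(1)
  proof (cases rule: Zset_cases)
    case (3 z)
    then show ?thesis using between[OF that(1)] that(2) by auto
  qed (use p q0 in auto)
  have "AE w in zmarg Z0 \<alpha>. q w = p w"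
    using equilibrium_AE_conjugates(1)[OF eqm] AE_zmarg_Zset by eventually_elim (rule eq)
  moreover have "U x w - q w \<le> psharp Z0 U p x" if "x \<in> X" "w \<in> Zset Z0" for x w
    using D.psharpsharp_upper[OF p(1) that] between[OF that(2)] by linarith
  ultimately have dq: "demand_dist X Z0 U mu q \<alpha>"
    by (rule D.demand_dist_change_price[OF p(1) d])
  have "AE w in zmarg Z0 \<beta>. - q w = - p w"
    using equilibrium_AE_conjugates(2)[OF eqm] AE_zmarg_Zset by eventually_elim (simp add: eq)
  moreover have "- V y w - - q w \<le> psharp Z0 (\<lambda>y w. - V y w) (\<lambda>w. - p w) y" if "y \<in> Y" "w \<in> Zset Z0" for y w
    using S.psharpsharp_upper[OF p(2) that] between[OF that(2)] by (simp add: pflatflat_eq_psharpsharp)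
  ultimately have "demand_dist Y Z0 (\<lambda>y w. - V y w) nu (\<lambda>w. - q w) \<beta>"
    by (rule S.demand_dist_change_price[OF p(2) d'])
  with dq q mc show ?thesis by (simp add: equilibrium_iff)
qed

text \<open>Market clearing makes the prices drop out of the sum of the two duality gaps.\<close>

lemma surplus_le:
  assumes eqm: "equilibrium X Y Z0 U V mu nu p \<alpha> \<beta>" and q: "admissible X Y Z0 U V q"
  defines "surplus \<equiv> (\<integral>z. U (fst z) (snd z) \<partial>\<alpha>) + (\<integral>z. - V (fst z) (snd z) \<partial>\<beta>)"
    and "J \<equiv> (\<integral>x. psharp Z0 U q x \<partial>mu) + (\<integral>y. psharp Z0 (\<lambda>y w. - V y w) (\<lambda>w. - q w) y \<partial>nu)"
  shows "surplus \<le> J" and "surplus = J \<longleftrightarrow> equilibrium X Y Z0 U V mu nu q \<alpha> \<beta>"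
proof -
  note e = eqm[unfolded equilibrium_iff]
  then have p: "continuous_on (Zset Z0) p" "continuous_on (Zset Z0) (\<lambda>w. - p w)"
    using admissibleD by blast+
  note q' = admissibleD[OF q]
  have d: "demand_dist X Z0 U mu p \<alpha>" "demand_dist Y Z0 (\<lambda>y w. - V y w) nu (\<lambda>w. - p w) \<beta>"
    and c: "market_clearing Z0 \<alpha> \<beta>" using e by auto
  have cancel: "(\<integral>w. - q w \<partial>zmarg Z0 \<beta>) = - (\<integral>w. q w \<partial>zmarg Z0 \<alpha>)"
    using integral_market_clearing[OF D.Z0 c q'(3,4)] by simp
  note gD = D.duality_gap[OF p(1) d(1) q'(1)] and gS = S.duality_gap[OF p(2) d(2) q'(2)]
  show "surplus \<le> J"
    using gD(1) gS(1) cancel unfolding surplus_def J_def by linarith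
  show "surplus = J \<longleftrightarrow> equilibrium X Y Z0 U V mu nu q \<alpha> \<beta>"
    unfolding equilibrium_iff gD(2)[symmetric] gS(2)[symmetric]
    using gD(1) gS(1) cancel q c unfolding surplus_def J_def by auto
qed

text \<open>Surplus is bounded by the dual value of every admissible price. Chaining the bounds,
  surplus(alpha, beta) <= J(q) = surplus(alpha', beta') <= J(p) = surplus(alpha, beta), so all are
  equal, and equality characterises equilibrium.\<close>

lemma equilibrium_exchange:
  assumes p: "equilibrium X Y Z0 U V mu nu p \<alpha> \<beta>" and q: "equilibrium X Y Z0 U V mu nu q \<alpha>' \<beta>'"
  shows "equilibrium X Y Z0 U V mu nu q \<alpha> \<beta>"
proof -
  have ap: "admissible X Y Z0 U V p" "admissible X Y Z0 U V q"
    using p q by (auto simp: equilibrium_iff)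
  note Jp = surplus_le(2)[OF p ap(1), THEN iffD2, OF p] and Jq = surplus_le(2)[OF q ap(2), THEN iffD2, OF q]
  show ?thesis
    by (rule surplus_le(2)[OF p ap(2), THEN iffD1])
      (use Jp Jq surplus_le(1)[OF p ap(2)] surplus_le(1)[OF q ap(1)] in linarith)
qed

lemma admissible_convex:
  assumes p: "admissible X Y Z0 U V p" and q: "admissible X Y Z0 U V q" and t: "0 \<le> t" "t \<le> 1"
  shows "admissible X Y Z0 U V (\<lambda>w. (1 - t) * p w + t * q w)"
proof -
  have "afun Y V w \<le> (1 - t) * p w + t * q w \<and> (1 - t) * p w + t * q w \<le> bfun X U w"
    if "w \<in> Z1set X Y Z0 U V" for w
  proof -
    have "afun Y V w \<le> p w" "p w \<le> bfun X U w" "afun Y V w \<le> q w" "q w \<le> bfun X U w"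
      using p q that by (auto simp: admissible_def)
    then show ?thesis
      using convex_bound_le[of "p w" "bfun X U w" "q w" "1 - t" t] convex_bound_le[of "- p w" "- afun Y V w" "- q w" "1 - t" t] t
      by simp
  qed
  then show ?thesis
    using p q by (auto simp: admissible_def price_system_def intro!: continuous_intros)
qed

lemma equilibrium_convex:
  assumes "equilibrium X Y Z0 U V mu nu p \<alpha> \<beta>" "equilibrium X Y Z0 U V mu nu q \<alpha> \<beta>" "0 \<le> t" "t \<le> 1"
  shows "equilibrium X Y Z0 U V mu nu (\<lambda>w. (1 - t) * p w + t * q w) \<alpha> \<beta>"
proof -
  have "demand_dist Y Z0 (\<lambda>y w. - V y w) nu (\<lambda>w. (1 - t) * - p w + t * - q w) \<beta>"
    using assms by (intro demand_dist_convex) (auto simp: equilibrium_iff)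
  moreover have "(\<lambda>w. (1 - t) * - p w + t * - q w) = (\<lambda>w. - ((1 - t) * p w + t * q w))"
    by (simp add: algebra_simps)
  ultimately show ?thesis
    using assms admissible_convex[of p q t] demand_dist_convex[of X Z0 U mu p \<alpha> q t] by (simp add: equilibrium_iff)
qed

text \<open>A market-clearing price need not be admissible where nothing is traded.  Clipping it between
  \<open>min a b\<close> and \<open>max a b\<close> changes it only off the support of the traded qualities, and never makes a
  quality attractive that was not.\<close>

lemma equilibrium_by_clipping:
  assumes p: "price_system Z0 p" and \<alpha>: "demand_dist X Z0 U mu p \<alpha>"
    and \<beta>: "demand_dist Y Z0 (\<lambda>y w. - V y w) nu (\<lambda>w. - p w) \<beta>" and clear: "market_clearing Z0 \<alpha> \<beta>"
  shows "\<exists>q. equilibrium X Y Z0 U V mu nu q \<alpha> \<beta>"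
proof -
  define a b where "a = afun Y V" and "b = bfun X U"
  define q where "q w = (if w \<in> zemb ` Z0 then max (min (a w) (b w)) (min (p w) (max (a w) (b w))) else 0)" for w
  have p': "continuous_on (Zset Z0) p" "continuous_on (Zset Z0) (\<lambda>w. - p w)" "p znd = 0" "p zns = 0"
    using p by (auto simp: price_system_def intro: continuous_intros)
  have ca: "continuous_on (Zset Z0) a"
    using S.continuous_on_bfun unfolding a_def afun_eq_bfun[abs_def] by (rule continuous_on_minus)
  have cb: "continuous_on (Zset Z0) b" unfolding b_def by (rule D.continuous_on_bfun)
  have cq: "continuous_on (Zset Z0) q"
  proof (rule continuous_on_ZsetI[OF D.Z0])
    have "continuous_on (zemb ` Z0) (\<lambda>w. max (min (a w) (b w)) (min (p w) (max (a w) (b w))))"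
      using ca cb p'(1) by (intro continuous_intros; elim continuous_on_subset[OF _ zemb_subset_Zset])
    then show "continuous_on (zemb ` Z0) q" by (rule continuous_on_eq) (simp add: q_def)
  qed
  have adm: "admissible X Y Z0 U V q"
    unfolding admissible_def price_system_def
  proof (intro conjI ballI)
    fix w assume w: "w \<in> Z1set X Y Z0 U V"
    then have "a w \<le> b w" "w \<in> Zset Z0" by (auto simp: Z1set_def a_def b_def)
    moreover have "w \<in> zemb ` Z0"
      using w null_notin_Z1set \<open>w \<in> Zset Z0\<close> Zset_minus_null_points by blast
    ultimately show "afun Y V w \<le> q w" "q w \<le> bfun X U w"
      by (auto simp: q_def a_def b_def)
  qed (use cq in \<open>auto simp: q_def[of znd] q_def[of zns]\<close>)
  have "AE w in zmarg Z0 \<alpha>. p w \<le> b w"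
    unfolding b_def using D.AE_price_le_bfun[OF p'(1) \<alpha> p'(3)] U_null by simp
  moreover have "AE w in zmarg Z0 \<beta>. - p w \<le> - a w"
    unfolding a_def afun_eq_bfun using S.AE_price_le_bfun[OF p'(2) \<beta>, of zns] p' V_null by simp
  then have ap: "AE w in zmarg Z0 \<beta>. w \<in> zemb ` Z0 \<longrightarrow> a w \<le> p w"
    by eventually_elim simp
  then have "AE w in zmarg Z0 \<alpha>. w \<in> zemb ` Z0 \<longrightarrow> a w \<le> p w"
    unfolding AE_market_clearing[OF D.Z0 clear] .
  \<comment> \<open>At traded genuine qualities a <= p <= b, so clipping does nothing there.\<close>
  ultimately have *: "AE w in zmarg Z0 \<alpha>. w \<in> zemb ` Z0 \<longrightarrow> q w = p w"
    by eventually_elim (auto simp: q_def)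
  have null: "q w = p w" if "w \<in> Zset Z0" "w \<notin> zemb ` Z0" for w
    using that p' by (auto simp: Zset_def q_def)
  have "AE w in zmarg Z0 \<alpha>. q w = p w"
    using * AE_zmarg_Zset by eventually_elim (use null in blast)
  moreover have "U x w - q w \<le> psharp Z0 U p x" if "x \<in> X" "w \<in> Zset Z0" for x w
  proof (cases "p w \<le> q w")
    case True
    then show ?thesis using D.psharp_upper[OF p'(1) that] by linarith
  next
    case False
    \<comment> \<open>The clip lowered the price, so q w = max a b. At such a price no consumer has
      positive net utility, and the outside option already offered 0.\<close>
    then have "b w \<le> q w" using null[OF that(2)] by (auto simp: q_def split: if_splits)
    moreover have "U x w \<le> b w" unfolding b_def using that by (rule D.bfun_upper)
    moreover have "0 \<le> psharp Z0 U p x"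
      using D.psharp_upper[OF p'(1) that(1), of znd] U_null p' by simp
    ultimately show ?thesis by linarith
  qed
  ultimately have dq: "demand_dist X Z0 U mu q \<alpha>"
    by (rule D.demand_dist_change_price[OF p'(1) \<alpha>])
  have "AE w in zmarg Z0 \<beta>. w \<in> zemb ` Z0 \<longrightarrow> q w = p w"
    using * unfolding AE_market_clearing[OF D.Z0 clear] .
  then have "AE w in zmarg Z0 \<beta>. - q w = - p w"
    using AE_zmarg_Zset by eventually_elim (use null in auto)
  moreover have "- V y w - - q w \<le> psharp Z0 (\<lambda>y w. - V y w) (\<lambda>w. - p w) y" if "y \<in> Y" "w \<in> Zset Z0" for y w
  proof (cases "q w \<le> p w")
    case True
    then show ?thesis using S.psharp_upper[OF p'(2) that] by linarith
  next
    case False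
    \<comment> \<open>Symmetrically the price was raised to min a b, and no supplier does better
      than its own outside option.\<close>
    then have "q w \<le> a w" using null[OF that(2)] by (auto simp: q_def split: if_splits)
    moreover have "a w \<le> V y w" unfolding a_def afun_eq_bfun using S.bfun_upper[OF that] by simp
    moreover have "0 \<le> psharp Z0 (\<lambda>y w. - V y w) (\<lambda>w. - p w) y"
      using S.psharp_upper[OF p'(2) that(1), of zns] V_null p' by simp
    ultimately show ?thesis by linarith
  qed
  ultimately have "demand_dist Y Z0 (\<lambda>y w. - V y w) nu (\<lambda>w. - q w) \<beta>"
    by (rule S.demand_dist_change_price[OF p'(2) \<beta>])
  with dq adm clear show ?thesis by (auto simp: equilibrium_iff)
qed

end

section \<open>Existence\<close>

lemma (in demand_side) uniformly_continuous_in_quality: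
  assumes "0 < e"
  shows "\<exists>d>0. \<forall>x\<in>X. \<forall>w\<in>Zset Z0. \<forall>w'\<in>Zset Z0. dist w w' < d \<longrightarrow> \<bar>U x w - U x w'\<bar> \<le> e"
proof -
  have "uniformly_continuous_on (X \<times> Zset Z0) (\<lambda>(x, w). U x w)"
    by (rule compact_uniformly_continuous[OF U compact_domain])
  then obtain d where d: "d > 0"
    "\<And>z z'. z \<in> X \<times> Zset Z0 \<Longrightarrow> z' \<in> X \<times> Zset Z0 \<Longrightarrow> dist z' z < d \<Longrightarrow>
      dist (case z' of (x, w) \<Rightarrow> U x w) (case z of (x, w) \<Rightarrow> U x w) < e"
    unfolding uniformly_continuous_on_def using assms by blast
  have "\<bar>U x w - U x w'\<bar> \<le> e" if "x \<in> X" "w \<in> Zset Z0" "w' \<in> Zset Z0" "dist w w' < d" for x w w'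
    using d(2)[of "(x, w')" "(x, w)"] that by (simp add: dist_Pair_Pair dist_real_def)
  with d(1) show ?thesis by blast
qed

lemma (in demand_side) bounded_utility:
  obtains C where "\<And>x w. x \<in> X \<Longrightarrow> w \<in> Zset Z0 \<Longrightarrow> \<bar>U x w\<bar> \<le> C"
proof -
  obtain C where "\<And>z. z \<in> X \<times> Zset Z0 \<Longrightarrow> norm (case z of (x, w) \<Rightarrow> U x w) \<le> C"
    using compact_imp_bounded[OF compact_continuous_image[OF U compact_domain]] by (auto simp: bounded_iff)
  from this[of "(_, _)"] show thesis by (intro that) auto
qed

text \<open>The added points are forced into the grid because every logit choice must include the
  outside options.\<close>

lemma Zset_finite_net:
  assumes "compact Z0" "0 < \<delta>"
  obtains T where "finite T" "T \<subseteq> Zset Z0" "znd \<in> T" "zns \<in> T"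
    "\<And>w. w \<in> Zset Z0 \<Longrightarrow> \<exists>k\<in>T. dist w k < \<delta>"
proof -
  obtain T where T: "T \<subseteq> Zset Z0" "finite T" "Zset Z0 \<subseteq> (\<Union>k\<in>T. ball k \<delta>)"
    by (rule compact_finite_net[OF compact_Zset[OF assms(1)] assms(2)])
  have "\<exists>k\<in>insert znd (insert zns T). dist w k < \<delta>" if w: "w \<in> Zset Z0" for w
  proof -
    obtain k where "k \<in> T" "w \<in> ball k \<delta>" using T(3) w by blast
    then show ?thesis by (auto simp: dist_commute)
  qed
  then show thesis using T by (intro that[of "insert znd (insert zns T)"]) auto
qed

context hedonic_market
begin

text \<open>Delivers everything required of an equilibrium except admissibility of the price. Exact
  clearing at each finite stage is a linear identity between sums, so it survives the weak
  limit.\<close>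

lemma exists_clearing_price:
  obtains p \<alpha> \<beta> where "price_system Z0 p" "demand_dist X Z0 U mu p \<alpha>"
    "demand_dist Y Z0 (\<lambda>y w. - V y w) nu (\<lambda>w. - p w) \<beta>" "market_clearing Z0 \<alpha> \<beta>"
proof -
  define V' where "V' y w = - V y w" for y w
  obtain C1 C2 where C1: "\<And>x w. x \<in> X \<Longrightarrow> w \<in> Zset Z0 \<Longrightarrow> \<bar>U x w\<bar> \<le> C1"
    and C2: "\<And>y w. y \<in> Y \<Longrightarrow> w \<in> Zset Z0 \<Longrightarrow> \<bar>V' y w\<bar> \<le> C2"
    using D.bounded_utility S.bounded_utility unfolding V'_def by metis
  define C where "C = max C1 C2"
  have CU: "\<bar>U x w\<bar> \<le> C" if "x \<in> X" "w \<in> Zset Z0" for x w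
    using C1[OF that] by (simp add: C_def)
  have CV: "\<bar>V' y w\<bar> \<le> C" if "y \<in> Y" "w \<in> Zset Z0" for y w
    using C2[OF that] by (simp add: C_def)
  obtain I m where Im: "\<forall>n. finite (I n) \<and> I n \<subseteq> X \<and> (\<forall>i. 0 \<le> m n i) \<and> 0 < sum (m n) (I n)"
    and mlim: "\<forall>f::_ \<Rightarrow> real. continuous_on X f \<longrightarrow> (\<lambda>n. \<Sum>i\<in>I n. m n i * f i) \<longlonglongrightarrow> (\<integral>x. f x \<partial>mu)"
    using finitely_supported_approximation[OF D.X D.mu] by (elim exE conjE) (rule that, assumption+)
  then have I: "\<And>n. finite (I n)" "\<And>n. I n \<subseteq> X" "\<And>n i. 0 \<le> m n i" "\<And>n. 0 < sum (m n) (I n)"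
    by blast+
  obtain J l where Jl: "\<forall>n. finite (J n) \<and> J n \<subseteq> Y \<and> (\<forall>j. 0 \<le> l n j) \<and> 0 < sum (l n) (J n)"
    and llim: "\<forall>f::_ \<Rightarrow> real. continuous_on Y f \<longrightarrow> (\<lambda>n. \<Sum>j\<in>J n. l n j * f j) \<longlonglongrightarrow> (\<integral>y. f y \<partial>nu)"
    using finitely_supported_approximation[OF S.X S.mu] by (elim exE conjE) (rule that, assumption+)
  then have J: "\<And>n. finite (J n)" "\<And>n. J n \<subseteq> Y" "\<And>n j. 0 \<le> l n j" "\<And>n. 0 < sum (l n) (J n)"
    by blast+
  define R where "R n T \<longleftrightarrow> finite T \<and> T \<subseteq> Zset Z0 \<and> znd \<in> T \<and> zns \<in> T \<and>
    (\<forall>w\<in>Zset Z0. \<exists>k\<in>T. dist w k < inverse (real (Suc n)))" for n and T :: "('z \<times> real) set"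
  have "\<exists>T. R n T" for n
  proof -
    obtain T where "finite T" "T \<subseteq> Zset Z0" "znd \<in> T" "zns \<in> T"
      "\<And>w. w \<in> Zset Z0 \<Longrightarrow> \<exists>k\<in>T. dist w k < inverse (real (Suc n))"
      by (rule Zset_finite_net[OF D.Z0, of "inverse (real (Suc n))"]) auto
    then show ?thesis unfolding R_def by blast
  qed
  then obtain G where "\<And>n. R n (G n)" by metis
  then have G: "\<And>n. finite (G n)" "\<And>n. G n \<subseteq> Zset Z0" "\<And>n. znd \<in> G n" "\<And>n. zns \<in> G n"
    and net: "\<And>n w. w \<in> Zset Z0 \<Longrightarrow> \<exists>k\<in>G n. dist w k < inverse (real (Suc n))"
    unfolding R_def by blast+
  have Gne: "G n \<noteq> {}" for n using G(3) by blast
  define L where "L n = ln (real (card (G n))) + \<bar>ln (sum (m n) (I n)) - ln (sum (l n) (J n))\<bar>" for n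
  \<comment> \<open>The two summands serve two demands: L n gives eps * L n <= 1, the condition for
    the price box, and the other makes the number of grid points times eps at most 1/(n+1).\<close>
  define \<epsilon> where "\<epsilon> n = 1 / (real (Suc n) * real (card (G n)) + L n)" for n
  have cG: "1 \<le> real (card (G n))" for n
    using Gne[of n] G(1)[of n] by (simp add: Suc_le_eq card_gt_0_iff)
  then have L: "0 \<le> L n" for n unfolding L_def by (simp add: add_nonneg_nonneg)
  have SG: "0 < real (Suc n) * real (card (G n))" for n
    using cG[of n] by (intro mult_pos_pos) auto
  have \<epsilon>: "0 < \<epsilon> n" for n
    using SG[of n] L[of n] unfolding \<epsilon>_def by (intro divide_pos_pos add_pos_nonneg) auto
  have \<epsilon>L: "\<epsilon> n * L n \<le> 1" for n
    using SG[of n] L[of n] unfolding \<epsilon>_def by (simp add: divide_le_eq del: of_nat_Suc)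
  have \<epsilon>G: "real (card (G n)) * \<epsilon> n \<le> inverse (real (Suc n))" for n
  proof -
    have "real (card (G n)) * \<epsilon> n \<le> real (card (G n)) * (1 / (real (Suc n) * real (card (G n))))"
      unfolding \<epsilon>_def using SG[of n] L[of n] less_le_trans[OF zero_less_one cG[of n]] by (intro mult_left_mono divide_left_mono mult_pos_pos add_pos_nonneg) auto
    also have "\<dots> = inverse (real (Suc n))"
      using cG[of n] by (simp add: divide_simps)
    finally show ?thesis .
  qed
  \<comment> \<open>The oscillation clause quantifies over all of X and Y rather than the sampled
    agents, so the resulting modulus of continuity is the same for all n.\<close>
  define Q where "Q n p \<longleftrightarrow> p znd = 0 \<and> p zns = 0 \<and> (\<forall>w\<in>Zset Z0. \<bar>p w\<bar> \<le> 3 * C + 1) \<and>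
    (\<forall>w\<in>zemb ` Z0. (\<Sum>i\<in>I n. m n i * logit (G n) (\<epsilon> n) U p i w) = (\<Sum>j\<in>J n. l n j * logit (G n) (\<epsilon> n) V' (\<lambda>w. - p w) j w)) \<and>
    (\<forall>w\<in>zemb ` Z0. \<forall>w'\<in>zemb ` Z0. \<forall>\<delta>. (\<forall>x\<in>X. \<bar>U x w - U x w'\<bar> \<le> \<delta>) \<longrightarrow> (\<forall>y\<in>Y. \<bar>V' y w - V' y w'\<bar> \<le> \<delta>) \<longrightarrow>
      \<bar>p w - p w'\<bar> \<le> \<delta>)" for n p
  have "\<exists>p. Q n p" for n
  proof -
    obtain p where p: "p znd = 0" "p zns = 0" "\<And>w. w \<in> Zset Z0 \<Longrightarrow> \<bar>p w\<bar> \<le> 3 * C + 1"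
      "\<And>w. w \<in> Zset Z0 - {znd, zns} \<Longrightarrow>
        (\<Sum>i\<in>I n. m n i * logit (G n) (\<epsilon> n) U p i w) = (\<Sum>j\<in>J n. l n j * logit (G n) (\<epsilon> n) V' (\<lambda>w. - p w) j w)"
      "\<And>w w' \<delta>. w \<in> Zset Z0 - {znd, zns} \<Longrightarrow> w' \<in> Zset Z0 - {znd, zns} \<Longrightarrow> (\<And>i. i \<in> I n \<Longrightarrow> \<bar>U i w - U i w'\<bar> \<le> \<delta>) \<Longrightarrow>
        (\<And>j. j \<in> J n \<Longrightarrow> \<bar>V' j w - V' j w'\<bar> \<le> \<delta>) \<Longrightarrow> \<bar>p w - p w'\<bar> \<le> \<delta>"
    proof (rule logit_equilibrium[of "I n" "m n" "J n" "l n" "G n" "Zset Z0" znd zns "\<epsilon> n" U C V'])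
      show "\<epsilon> n * (ln (real (card (G n))) + \<bar>ln (sum (m n) (I n)) - ln (sum (l n) (J n))\<bar>) \<le> 1"
        using \<epsilon>L[of n] by (simp only: L_def)
      show "\<bar>U i w\<bar> \<le> C" if "i \<in> I n" "w \<in> Zset Z0" for i w using CU I(2) that by blast
      show "\<bar>V' j w\<bar> \<le> C" if "j \<in> J n" "w \<in> Zset Z0" for j w using CV J(2) that by blast
      show "V' j zns = 0" for j by (simp add: V'_def V_null)
    qed (use I J G \<epsilon> U_null in auto)
    have "Q n p"
      unfolding Q_def
    proof (intro conjI ballI allI impI)
      fix w w' \<delta> assume w: "w \<in> zemb ` Z0" "w' \<in> zemb ` Z0"
        and osc: "\<forall>x\<in>X. \<bar>U x w - U x w'\<bar> \<le> \<delta>" "\<forall>y\<in>Y. \<bar>V' y w - V' y w'\<bar> \<le> \<delta>"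
      show "\<bar>p w - p w'\<bar> \<le> \<delta>"
        by (rule p(5)[unfolded Zset_minus_null_points, OF w]) (use osc I(2) J(2) in blast)+
    qed (rule p(1-3) p(4)[unfolded Zset_minus_null_points] | assumption)+
    then show ?thesis by (rule exI[of "Q n" p])
  qed
  then obtain P where P: "\<And>n. Q n (P n)" by metis
  note P' = P[unfolded Q_def]
  note P0 = P'[THEN conjunct1] P'[THEN conjunct2, THEN conjunct1]
    and Pbound = P'[THEN conjunct2, THEN conjunct2, THEN conjunct1, rule_format]
    and Pclear = P'[THEN conjunct2, THEN conjunct2, THEN conjunct2, THEN conjunct1, rule_format]
    and Posc = P'[THEN conjunct2, THEN conjunct2, THEN conjunct2, THEN conjunct2, rule_format]
  \<comment> \<open>Arzela-Ascoli is applied on the genuine qualities, where the oscillation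
    estimate holds; at the added points all prices are 0.\<close>
  obtain g s where g: "continuous_on (zemb ` Z0) g" and s: "strict_mono (s :: nat \<Rightarrow> nat)"
    and conv: "\<And>e. 0 < e \<Longrightarrow> \<exists>N. \<forall>n w. n \<ge> N \<and> w \<in> zemb ` Z0 \<longrightarrow> norm (P (s n) w - g w) < e"
  proof (rule Arzela_Ascoli[OF compact_zemb_image[OF D.Z0], of P "3 * C + 1"])
    show "norm (P n w) \<le> 3 * C + 1" if "w \<in> zemb ` Z0" for n w
      using Pbound[OF subsetD[OF zemb_subset_Zset that]] by simp
    fix w :: "'z \<times> real" and e :: real assume w: "w \<in> zemb ` Z0" and e: "0 < e"
    obtain d1 where d1: "0 < d1"
      "\<forall>x\<in>X. \<forall>w\<in>Zset Z0. \<forall>w'\<in>Zset Z0. dist w w' < d1 \<longrightarrow> \<bar>U x w - U x w'\<bar> \<le> e / 2"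
      using D.uniformly_continuous_in_quality[OF half_gt_zero[OF e]] by blast
    obtain d2 where d2: "0 < d2"
      "\<forall>y\<in>Y. \<forall>w\<in>Zset Z0. \<forall>w'\<in>Zset Z0. dist w w' < d2 \<longrightarrow> \<bar>V' y w - V' y w'\<bar> \<le> e / 2"
      using S.uniformly_continuous_in_quality[OF half_gt_zero[OF e]] unfolding V'_def by blast
    have "norm (P n w - P n w') < e" if w': "w' \<in> zemb ` Z0" "norm (w - w') < min d1 d2" for n w'
    proof -
      have "w \<in> Zset Z0" "w' \<in> Zset Z0" using w w'(1) zemb_subset_Zset by blast+
      then have "\<bar>P n w - P n w'\<bar> \<le> e / 2"
        using w' w d1(2) d2(2) by (intro Posc) (auto simp: dist_norm)
      then show ?thesis using e by simp
    qed
    then show "\<exists>d. 0 < d \<and> (\<forall>n w'. w' \<in> zemb ` Z0 \<and> norm (w - w') < d \<longrightarrow> norm (P n w - P n w') < e)"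
      using d1(1) d2(1) by (intro exI[of _ "min d1 d2"]) auto
  qed blast
  define p where "p w = (if w \<in> zemb ` Z0 then g w else 0)" for w
  have cp: "continuous_on (Zset Z0) p"
    using g by (intro continuous_on_ZsetI[OF D.Z0]) (auto elim: continuous_on_eq simp: p_def)
  then have cp': "continuous_on (Zset Z0) (\<lambda>w. - p w)" by (rule continuous_on_minus)
  have unif: "\<exists>N. \<forall>n\<ge>N. \<forall>w\<in>Zset Z0. \<bar>P (s n) w - p w\<bar> < e" if e: "0 < e" for e
  proof -
    obtain N where N: "\<And>n w. n \<ge> N \<Longrightarrow> w \<in> zemb ` Z0 \<Longrightarrow> norm (P (s n) w - g w) < e"
      using conv[OF e] by blast
    have "\<bar>P (s n) w - p w\<bar> < e" if "n \<ge> N" "w \<in> Zset Z0" for n w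
      using that(2) N[OF that(1)] e P0 by (cases rule: Zset_cases) (auto simp: p_def)
    then show ?thesis by blast
  qed
  have sub: "inverse (real (Suc (t n))) \<le> inverse (real (Suc n))" if "strict_mono t" for t :: "nat \<Rightarrow> nat" and n
    using seq_suble[OF that, of n] by simp
  have dense: "\<exists>N. \<forall>n\<ge>N. \<forall>w\<in>Zset Z0. \<exists>k\<in>G (t n). dist w k < \<delta>" if t: "strict_mono t" and \<delta>: "0 < \<delta>" for t :: "nat \<Rightarrow> nat" and \<delta>
  proof -
    obtain N where N: "inverse (real (Suc N)) < \<delta>" using reals_Archimedean[OF \<delta>] by blast
    have "\<exists>k\<in>G (t n). dist w k < \<delta>" if n: "n \<ge> N" and w: "w \<in> Zset Z0" for n w
    proof -
      have "inverse (real (Suc n)) \<le> inverse (real (Suc N))" using n by simp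
      then have le: "inverse (real (Suc (t n))) < \<delta>" using sub[OF t, of n] N by linarith
      obtain k where "k \<in> G (t n)" "dist w k < inverse (real (Suc (t n)))"
        using net[OF w, of "t n"] by blast
      then show ?thesis using less_trans[OF _ le] by blast
    qed
    then show ?thesis by blast
  qed
  have \<epsilon>lim: "(\<lambda>n. real (card (G (t n))) * \<epsilon> (t n)) \<longlonglongrightarrow> 0" if t: "strict_mono t" for t :: "nat \<Rightarrow> nat"
  proof (rule real_tendsto_sandwich[OF _ _ tendsto_const LIMSEQ_inverse_real_of_nat])
    show "\<forall>\<^sub>F n in sequentially. 0 \<le> real (card (G (t n))) * \<epsilon> (t n)"
      using \<epsilon> by (intro always_eventually allI mult_nonneg_nonneg) (auto simp: less_imp_le)
    show "\<forall>\<^sub>F n in sequentially. real (card (G (t n))) * \<epsilon> (t n) \<le> inverse (real (Suc n))"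
      by (intro always_eventually allI order_trans[OF \<epsilon>G sub[OF t]])
  qed
  \<comment> \<open>The subsequences are nested: \<open>s\<close> for the prices, \<open>r\<close>
    for demand, and \<open>r'\<close> below for supply, so that all three limits hold along the last
    one.\<close>
  obtain r \<alpha> where r: "strict_mono r" and \<alpha>: "finite_measure \<alpha>" "sets \<alpha> = sets (restrict_space borel (X \<times> Zset Z0))"
    "AE xw in \<alpha>. snd xw \<in> Zset Z0 \<and> (\<forall>w'\<in>Zset Z0. U (fst xw) w' - p w' \<le> U (fst xw) (snd xw) - p (snd xw))"
    "distr \<alpha> (restrict_space borel X) fst = mu"
    and \<alpha>lim: "\<And>f. continuous_on (X \<times> Zset Z0) f \<Longrightarrow>
       (\<lambda>n. \<Sum>k\<in>G (s (r n)). \<Sum>i\<in>I (s (r n)). m (s (r n)) i * logit (G (s (r n))) (\<epsilon> (s (r n))) U (P (s (r n))) i k * f (i, k))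
         \<longlonglongrightarrow> (\<integral>xw. f xw \<partial>\<alpha>)"
  proof (rule logit_demand_limit[OF D.X(1) compact_Zset[OF D.Z0] D.Zset_nonempty D.mu D.U cp unif,
        of "\<lambda>n. I (s n)" "\<lambda>n. m (s n)" "\<lambda>n. G (s n)" "\<lambda>n. \<epsilon> (s n)"])
    fix f :: "'x \<Rightarrow> real" assume "continuous_on X f"
    from LIMSEQ_subseq_LIMSEQ[OF mlim[rule_format, OF this] s]
    show "(\<lambda>n. \<Sum>i\<in>I (s n). m (s n) i * f i) \<longlonglongrightarrow> (\<integral>x. f x \<partial>mu)" by (simp add: o_def)
  qed (use I G Gne \<epsilon> dense[OF s] \<epsilon>lim[OF s] in auto)
  have sr: "strict_mono (\<lambda>n. s (r n))" using s r by (simp add: strict_mono_def)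
  have unif': "\<exists>N. \<forall>n\<ge>N. \<forall>w\<in>Zset Z0. \<bar>- P (s (r n)) w - - p w\<bar> < e" if e: "0 < e" for e
  proof -
    obtain N where N: "\<And>n w. n \<ge> N \<Longrightarrow> w \<in> Zset Z0 \<Longrightarrow> \<bar>P (s n) w - p w\<bar> < e" using unif[OF e] by blast
    have "\<bar>- P (s (r n)) w - - p w\<bar> < e" if "n \<ge> N" "w \<in> Zset Z0" for n w
      using N[of "r n" w] that seq_suble[OF r, of n] by (simp add: abs_minus_commute)
    then show ?thesis by blast
  qed
  have SU: "continuous_on (Y \<times> Zset Z0) (\<lambda>(y, w). V' y w)" using S.U unfolding V'_def .
  obtain r' \<beta> where r': "strict_mono r'" and \<beta>: "finite_measure \<beta>" "sets \<beta> = sets (restrict_space borel (Y \<times> Zset Z0))"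
    "AE yw in \<beta>. snd yw \<in> Zset Z0 \<and> (\<forall>w'\<in>Zset Z0. V' (fst yw) w' - - p w' \<le> V' (fst yw) (snd yw) - - p (snd yw))"
    "distr \<beta> (restrict_space borel Y) fst = nu"
    and \<beta>lim: "\<And>f. continuous_on (Y \<times> Zset Z0) f \<Longrightarrow>
       (\<lambda>n. \<Sum>k\<in>G (s (r (r' n))). \<Sum>j\<in>J (s (r (r' n))). l (s (r (r' n))) j *
           logit (G (s (r (r' n)))) (\<epsilon> (s (r (r' n)))) V' (\<lambda>w. - P (s (r (r' n))) w) j k * f (j, k))
         \<longlonglongrightarrow> (\<integral>yw. f yw \<partial>\<beta>)"
  proof (rule logit_demand_limit[OF S.X(1) compact_Zset[OF D.Z0] D.Zset_nonempty S.mu SU cp',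
        of "\<lambda>n w. - P (s (r n)) w" "\<lambda>n. J (s (r n))" "\<lambda>n. l (s (r n))" "\<lambda>n. G (s (r n))" "\<lambda>n. \<epsilon> (s (r n))", OF unif'])
    fix f :: "'y \<Rightarrow> real" assume "continuous_on Y f"
    from LIMSEQ_subseq_LIMSEQ[OF llim[rule_format, OF this] sr]
    show "(\<lambda>n. \<Sum>j\<in>J (s (r n)). l (s (r n)) j * f j) \<longlonglongrightarrow> (\<integral>y. f y \<partial>nu)" by (simp add: o_def)
  qed (use J G Gne \<epsilon> dense[OF sr] \<epsilon>lim[OF sr] in auto)
  have dd: "demand_dist X Z0 U mu p \<alpha>"
    unfolding demand_dist_def Dcorr_def using \<alpha> by simp
  have sd: "demand_dist Y Z0 (\<lambda>y w. - V y w) nu (\<lambda>w. - p w) \<beta>"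
    unfolding demand_dist_def Dcorr_def using \<beta> by (simp add: V'_def)
  have "market_clearing Z0 \<alpha> \<beta>"
  proof (rule market_clearingI[OF D.Z0 D.finite_measure_zmarg[OF cp dd] S.finite_measure_zmarg[OF cp' sd]])
    fix f :: "'z \<times> real \<Rightarrow> real"
    assume f: "continuous_on (Zset Z0) f" and f0: "f znd = 0" "f zns = 0"
    \<comment> \<open>Terms at genuine qualities agree by clearing; at the two added points, where
      clearing fails in general, f is 0.\<close>
    have eq: "(\<Sum>k\<in>G n. \<Sum>i\<in>I n. m n i * logit (G n) (\<epsilon> n) U (P n) i k * f k)
        = (\<Sum>k\<in>G n. \<Sum>j\<in>J n. l n j * logit (G n) (\<epsilon> n) V' (\<lambda>w. - P n w) j k * f k)" for n
    proof (rule sum.cong[OF refl])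
      fix k assume "k \<in> G n"
      then have k: "k \<in> Zset Z0" using G(2) by blast
      show "(\<Sum>i\<in>I n. m n i * logit (G n) (\<epsilon> n) U (P n) i k * f k)
        = (\<Sum>j\<in>J n. l n j * logit (G n) (\<epsilon> n) V' (\<lambda>w. - P n w) j k * f k)"
      proof (cases "k \<in> zemb ` Z0")
        case True
        from Pclear[OF this, of n] show ?thesis by (simp flip: sum_distrib_right)
      next
        case False
        then have "f k = 0" using k f0 by (auto simp: Zset_def)
        then show ?thesis by simp
      qed
    qed
    have "(\<integral>z. f (snd z) \<partial>\<alpha>) = (\<integral>z. f (snd z) \<partial>\<beta>)"
    proof (rule LIMSEQ_unique)
      from LIMSEQ_subseq_LIMSEQ[OF \<alpha>lim[OF D.continuous_on_snd_price[OF f]] r']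
      show "(\<lambda>n. \<Sum>k\<in>G (s (r (r' n))). \<Sum>j\<in>J (s (r (r' n))). l (s (r (r' n))) j *
           logit (G (s (r (r' n)))) (\<epsilon> (s (r (r' n)))) V' (\<lambda>w. - P (s (r (r' n))) w) j k * f k)
         \<longlonglongrightarrow> (\<integral>z. f (snd z) \<partial>\<alpha>)"
        by (simp add: o_def eq)
      from \<beta>lim[OF S.continuous_on_snd_price[OF f]]
      show "(\<lambda>n. \<Sum>k\<in>G (s (r (r' n))). \<Sum>j\<in>J (s (r (r' n))). l (s (r (r' n))) j *
           logit (G (s (r (r' n)))) (\<epsilon> (s (r (r' n)))) V' (\<lambda>w. - P (s (r (r' n))) w) j k * f k)
         \<longlonglongrightarrow> (\<integral>z. f (snd z) \<partial>\<beta>)" by simp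
    qed
    then show "(\<integral>w. f w \<partial>zmarg Z0 \<alpha>) = (\<integral>w. f w \<partial>zmarg Z0 \<beta>)"
      by (simp add: D.integral_zmarg[OF cp dd f] S.integral_zmarg[OF cp' sd f])
  qed
  moreover have "price_system Z0 p" using cp by (simp add: price_system_def p_def)
  ultimately show thesis using dd sd that by blast
qed

end

theorem mainTheorem2:
  fixes X :: "'x::euclidean_space set" and Y :: "'y::euclidean_space set"
    and Z0 :: "'z::euclidean_space set"
    and mu :: "'x measure" and nu :: "'y measure"
    and u :: "'x \<Rightarrow> 'z \<Rightarrow> real" and v :: "'y \<Rightarrow> 'z \<Rightarrow> real"
  assumes X: "compact X" "X \<noteq> {}"
    and Y: "compact Y" "Y \<noteq> {}"
    and Z0: "compact Z0"
    and mu: "finite_measure mu" "sets mu = sets (restrict_space borel X)"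
    and nu: "finite_measure nu" "sets nu = sets (restrict_space borel Y)"
    and u_reg: "\<exists>N. open N \<and> X \<times> Z0 \<subseteq> N \<and> continuous_on N (\<lambda>(x, z). u x z) \<and>
        (\<exists>Du :: 'x \<Rightarrow> 'z \<Rightarrow> 'x \<Rightarrow>\<^sub>L real.
           (\<forall>(x, z) \<in> N. ((\<lambda>x'. u x' z) has_derivative blinfun_apply (Du x z)) (at x)) \<and>
           continuous_on N (\<lambda>(x, z). Du x z))"
    and v_reg: "\<exists>N. open N \<and> Y \<times> Z0 \<subseteq> N \<and> continuous_on N (\<lambda>(y, z). v y z) \<and>
        (\<exists>Dv :: 'y \<Rightarrow> 'z \<Rightarrow> 'y \<Rightarrow>\<^sub>L real.
           (\<forall>(y, z) \<in> N. ((\<lambda>y'. v y' z) has_derivative blinfun_apply (Dv y z)) (at y)) \<and>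
           continuous_on N (\<lambda>(y, z). Dv y z))"
  shows "(\<exists>p. equilibrium_price X Y Z0 (uext u) (vext v) mu nu p)
    \<and> (\<forall>p q (t::real). equilibrium_price X Y Z0 (uext u) (vext v) mu nu p
          \<and> equilibrium_price X Y Z0 (uext u) (vext v) mu nu q \<and> 0 \<le> t \<and> t \<le> 1
          \<longrightarrow> equilibrium_price X Y Z0 (uext u) (vext v) mu nu (\<lambda>w. (1 - t) * p w + t * q w))
    \<and> (\<forall>p q. equilibrium_price X Y Z0 (uext u) (vext v) mu nu p
          \<and> admissible X Y Z0 (uext u) (vext v) q
          \<and> (\<forall>w \<in> Zset Z0. psharpsharp X Z0 (uext u) p w \<le> q w \<and> q w \<le> pflatflat Y Z0 (vext v) p w)
          \<longrightarrow> equilibrium_price X Y Z0 (uext u) (vext v) mu nu q)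
    \<and> (\<forall>p \<alpha> \<beta>. equilibrium X Y Z0 (uext u) (vext v) mu nu p \<alpha> \<beta> \<longrightarrow>
          (AE w in zmarg Z0 \<alpha>. w \<in> zemb ` Z0 \<longrightarrow>
             psharpsharp X Z0 (uext u) p w = p w \<and> p w = pflatflat Y Z0 (vext v) p w) \<and>
          (AE w in zmarg Z0 \<beta>. w \<in> zemb ` Z0 \<longrightarrow>
             psharpsharp X Z0 (uext u) p w = p w \<and> p w = pflatflat Y Z0 (vext v) p w))"
proof -
  have cu: "continuous_on (X \<times> Z0) (\<lambda>(x, z). u x z)" and cv: "continuous_on (Y \<times> Z0) (\<lambda>(y, z). v y z)"
    using u_reg v_reg by (auto intro: continuous_on_subset)
  interpret hedonic_market X Y Z0 "uext u" "vext v" mu nu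
  proof (intro hedonic_market.intro demand_side.intro hedonic_market_axioms.intro)
    show "continuous_on (X \<times> Zset Z0) (\<lambda>(x, w). uext u x w)"
      by (rule continuous_on_uext[OF X(1) Z0 cu])
    show "continuous_on (Y \<times> Zset Z0) (\<lambda>(y, w). - vext v y w)"
      using continuous_on_minus[OF continuous_on_vext[OF Y(1) Z0 cv]] by (simp add: case_prod_unfold)
  qed (use X Y Z0 mu nu in auto)
  let ?eq = "equilibrium X Y Z0 (uext u) (vext v) mu nu"
  show ?thesis
    unfolding equilibrium_price_def
  proof (intro conjI allI impI)
    obtain p \<alpha> \<beta> where "price_system Z0 p" "demand_dist X Z0 (uext u) mu p \<alpha>"
      "demand_dist Y Z0 (\<lambda>y w. - vext v y w) nu (\<lambda>w. - p w) \<beta>" "market_clearing Z0 \<alpha> \<beta>"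
      by (rule exists_clearing_price)
    from equilibrium_by_clipping[OF this] show "\<exists>p \<alpha> \<beta>. ?eq p \<alpha> \<beta>" by blast
  next
    fix p q and t :: real
    assume "(\<exists>\<alpha> \<beta>. ?eq p \<alpha> \<beta>) \<and> (\<exists>\<alpha> \<beta>. ?eq q \<alpha> \<beta>) \<and> 0 \<le> t \<and> t \<le> 1"
    then obtain \<alpha> \<beta> \<alpha>' \<beta>' where p: "?eq p \<alpha> \<beta>" and q: "?eq q \<alpha>' \<beta>'" and t: "0 \<le> t" "t \<le> 1"
      by blast
    \<comment> \<open>Exchange first places q on the distributions of p; averaging is then done for
      one common pair.\<close>
    from equilibrium_convex[OF p equilibrium_exchange[OF p q] t]
    show "\<exists>\<alpha> \<beta>. ?eq (\<lambda>w. (1 - t) * p w + t * q w) \<alpha> \<beta>" by blast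
  next
    fix p q
    assume asm: "(\<exists>\<alpha> \<beta>. ?eq p \<alpha> \<beta>) \<and> admissible X Y Z0 (uext u) (vext v) q \<and>
      (\<forall>w\<in>Zset Z0. psharpsharp X Z0 (uext u) p w \<le> q w \<and> q w \<le> pflatflat Y Z0 (vext v) p w)"
    then obtain \<alpha> \<beta> where p: "?eq p \<alpha> \<beta>" by blast
    from equilibrium_between_conjugates[OF p] asm show "\<exists>\<alpha> \<beta>. ?eq q \<alpha> \<beta>" by blast
  qed (fact equilibrium_AE_conjugates)+
qed

end
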